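(* Let $\mathsf L$ be a canonical normal modal logic in the basic modal language such that $\mathsf{Fr}(\mathsf L)$ admits filtration. Then $\mu_c$-$\mathsf L$ is sound and complete with respect to $\mathsf{Fr}(\mathsf L)$: for every $\mu_c\mathsf{ML}$-formula $\varphi$, $\mu_c$-$\mathsf L\vdash\varphi$ if and only if $\varphi$ is valid in every frame of $\mathsf{Fr}(\mathsf L)$.
   Context: Syntax: over a countably infinite set $\mathsf P$ of variables, $\mu_c\mathsf{ML}$ consists of $p\mid\neg p\mid\varphi\lor\varphi\mid\varphi\land\varphi\mid\Diamond\varphi\mid\Box\varphi\mid\mu x.\varphi'\mid\nu x.\varphi''$ with $\varphi'\in\mathsf{Con}_{\{x\}}$, $\varphi''\in\mathsf{Cocon}_{\{x\}}$, where $\mathsf{Con}_X$ is generated by $x\in X$, $X$-free $\mu_c\mathsf{ML}$-formulas, $\lor,\land,\Diamond$ and $\mu y.\varphi'$ with $\varphi'\in\mathsf{Con}_{X\cup\{y\}}$, and $\mathsf{Cocon}_X$ dually with $\Box,\nu$. Kripke semantics is standard ($\mu,\nu$ least/greatest fixpoints); a formula is valid in a frame $(S,R)$ if it is true at every state of $(S,R,V)$ for every valuation $V$. $\mathsf{Fr}(\mathsf L)$ is the class of frames in which every formula of $\mathsf L$ is valid. $\mathsf L$ is canonical if its canonical frame (maximally $\mathsf L$-consistent sets of basic modal formulas, with $\Gamma R\Delta$ iff $\Box\varphi\in\Gamma\Rightarrow\varphi\in\Delta$) belongs to $\mathsf{Fr}(\mathsf L)$. Negation ${\sim}$ is the usual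 negation-normal-form negation with ${\sim}\eta x.\varphi=\overline\eta x.{\sim}\varphi[\neg x/x]$; $\varphi\to\psi$ abbreviates ${\sim}\varphi\lor\psi$. $\mu_c\mathsf K$ is the least set of formulas containing a complete axiomatisation of propositional logic, $\neg\Diamond\bot$, $\Diamond(p\lor q)\leftrightarrow(\Diamond p\lor\Diamond q)$, the prefixpoint axioms $\varphi[\mu x.\varphi/x]\to\mu x.\varphi$ for $\varphi\in\mathsf{Con}_{\{x\}}$, and closed under modus ponens, monotonicity (from $\varphi\to\psi$ derive $\Diamond\varphi\to\Diamond\psi$), uniform substitution and the least prefixpoint rule (from $\varphi[\gamma/x]\to\gamma$ with $\varphi\in\mathsf{Con}_{\{x\}}$ derive $\mu x.\varphi\to\gamma$), together with dual versions and rules expressing the duality of $\Diamond/\Box$ and $\mu/\nu$. A $\mu_c$-logic is an axiomatic extension of $\mu_c\mathsf K$ closed under these rules; $\mu_c$-$\mathsf L$ is the least $\mu_c$-logic containing $\mathsf L$. Filtration: FL-closure of $\Phi$ is the least $\Psi\supseteq\Phi$ closed under $\neg p\mapsto p$, $\varphi\circ\psi\mapsto\varphi,\psi$, $\heartsuit\varphi\mapsto\varphi$, $\eta x.\varphi\mapsto\varphi[\eta x.\varphi/x]$. For finite FL-closed $\Sigma$ and model $\mathbb S=(S,R,V)$, $s\sim_\Sigma s'$ iff they satisfy the same formulas of $\Sigma$; a filtration of $\mathbb S$ through $\Sigma$ is a model $(S/{\sim_\Sigma},R^\Sigma,V^\Sigma)$ with $R^{\min}\subseteq R^\Sigma\subseteq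 R^{\max}$ ($\overline sR^{\min}\overline t$ iff $Rs't'$ for some $s'\sim_\Sigma s,t'\sim_\Sigma t$; $\overline sR^{\max}\overline t$ iff for all $\Box\varphi\in\Sigma$, $s\Vdash\Box\varphi\Rightarrow t\Vdash\varphi$) and $V^\Sigma(p)=\{\overline s:s\Vdash p\}$ for $p\in\Sigma$. A class of frames $\mathcal F$ admits filtration if for every model whose underlying frame is in $\mathcal F$ and every finite FL-closed set $\Sigma$ of basic modal formulas, there is a filtration of that model through $\Sigma$ whose underlying frame is in $\mathcal F$. *)

theory Defs
  imports Main
begin

section \<open>Syntax\<close>

text \<open>The countably infinite set of variables is the type of natural numbers.  The datatype is
  that of all raw modal fixpoint formulas in negation normal form, with named bound variables; the
  basic modal formulas and the formulas of the continuous modal mu-calculus are carved out of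
  it below.\<close>

type_synonym var = nat

datatype form =
    Pos var
  | Neg var
  | Or form form
  | And form form
  | Dia form
  | Box form
  | Mu var form
  | Nu var form

primrec FV :: "form \<Rightarrow> var set" where
  "FV (Pos p) = {p}"
| "FV (Neg p) = {p}"
| "FV (Or \<phi> \<psi>) = FV \<phi> \<union> FV \<psi>"
| "FV (And \<phi> \<psi>) = FV \<phi> \<union> FV \<psi>"
| "FV (Dia \<phi>) = FV \<phi>"
| "FV (Box \<phi>) = FV \<phi>"
| "FV (Mu x \<phi>) = FV \<phi> - {x}"
| "FV (Nu x \<phi>) = FV \<phi> - {x}"

text \<open>\<open>mu_c \<phi>\<close>: \<open>\<phi>\<close> is a formula of the continuous modal mu-calculus.
  ``\<open>X\<close>-free'' means that no member of \<open>X\<close> occurs free.\<close>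

inductive mu_c :: "form \<Rightarrow> bool"
  and Con :: "var set \<Rightarrow> form \<Rightarrow> bool"
  and Cocon :: "var set \<Rightarrow> form \<Rightarrow> bool" where
  mu_c_Pos: "mu_c (Pos p)"
| mu_c_Neg: "mu_c (Neg p)"
| mu_c_Or: "mu_c \<phi> \<Longrightarrow> mu_c \<psi> \<Longrightarrow> mu_c (Or \<phi> \<psi>)"
| mu_c_And: "mu_c \<phi> \<Longrightarrow> mu_c \<psi> \<Longrightarrow> mu_c (And \<phi> \<psi>)"
| mu_c_Dia: "mu_c \<phi> \<Longrightarrow> mu_c (Dia \<phi>)"
| mu_c_Box: "mu_c \<phi> \<Longrightarrow> mu_c (Box \<phi>)"
| mu_c_Mu: "Con {x} \<phi> \<Longrightarrow> mu_c (Mu x \<phi>)"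
| mu_c_Nu: "Cocon {x} \<phi> \<Longrightarrow> mu_c (Nu x \<phi>)"
| Con_var: "x \<in> X \<Longrightarrow> Con X (Pos x)"
| Con_free: "mu_c \<phi> \<Longrightarrow> FV \<phi> \<inter> X = {} \<Longrightarrow> Con X \<phi>"
| Con_Or: "Con X \<phi> \<Longrightarrow> Con X \<psi> \<Longrightarrow> Con X (Or \<phi> \<psi>)"
| Con_And: "Con X \<phi> \<Longrightarrow> Con X \<psi> \<Longrightarrow> Con X (And \<phi> \<psi>)"
| Con_Dia: "Con X \<phi> \<Longrightarrow> Con X (Dia \<phi>)"
| Con_Mu: "Con (X \<union> {y}) \<phi> \<Longrightarrow> Con X (Mu y \<phi>)"
| Cocon_var: "x \<in> X \<Longrightarrow> Cocon X (Pos x)"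
| Cocon_free: "mu_c \<phi> \<Longrightarrow> FV \<phi> \<inter> X = {} \<Longrightarrow> Cocon X \<phi>"
| Cocon_Or: "Cocon X \<phi> \<Longrightarrow> Cocon X \<psi> \<Longrightarrow> Cocon X (Or \<phi> \<psi>)"
| Cocon_And: "Cocon X \<phi> \<Longrightarrow> Cocon X \<psi> \<Longrightarrow> Cocon X (And \<phi> \<psi>)"
| Cocon_Box: "Cocon X \<phi> \<Longrightarrow> Cocon X (Box \<phi>)"
| Cocon_Nu: "Cocon (X \<union> {y}) \<phi> \<Longrightarrow> Cocon X (Nu y \<phi>)"

primrec basic :: "form \<Rightarrow> bool" where
  "basic (Pos p) = True"
| "basic (Neg p) = True"
| "basic (Or \<phi> \<psi>) = (basic \<phi> \<and> basic \<psi>)"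
| "basic (And \<phi> \<psi>) = (basic \<phi> \<and> basic \<psi>)"
| "basic (Dia \<phi>) = basic \<phi>"
| "basic (Box \<phi>) = basic \<phi>"
| "basic (Mu x \<phi>) = False"
| "basic (Nu x \<phi>) = False"

text \<open>\<open>flip x \<phi>\<close> is the substitution instance \<open>\<phi>[\<not>x/x]\<close>.  Since the only free
  variable of \<open>\<not>x\<close> is \<open>x\<close> itself, no capture can occur.\<close>

primrec flip :: "var \<Rightarrow> form \<Rightarrow> form" where
  "flip x (Pos p) = (if p = x then Neg p else Pos p)"
| "flip x (Neg p) = (if p = x then Pos p else Neg p)"
| "flip x (Or \<phi> \<psi>) = Or (flip x \<phi>) (flip x \<psi>)"
| "flip x (And \<phi> \<psi>) = And (flip x \<phi>) (flip x \<psi>)"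
| "flip x (Dia \<phi>) = Dia (flip x \<phi>)"
| "flip x (Box \<phi>) = Box (flip x \<phi>)"
| "flip x (Mu y \<phi>) = Mu y (if y = x then \<phi> else flip x \<phi>)"
| "flip x (Nu y \<phi>) = Nu y (if y = x then \<phi> else flip x \<phi>)"

primrec neg :: "form \<Rightarrow> form" where
  "neg (Pos p) = Neg p"
| "neg (Neg p) = Pos p"
| "neg (Or \<phi> \<psi>) = And (neg \<phi>) (neg \<psi>)"
| "neg (And \<phi> \<psi>) = Or (neg \<phi>) (neg \<psi>)"
| "neg (Dia \<phi>) = Box (neg \<phi>)"
| "neg (Box \<phi>) = Dia (neg \<phi>)"
| "neg (Mu x \<phi>) = Nu x (flip x (neg \<phi>))"
| "neg (Nu x \<phi>) = Mu x (flip x (neg \<phi>))"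

definition imp :: "form \<Rightarrow> form \<Rightarrow> form" where
  "imp \<phi> \<psi> = Or (neg \<phi>) \<psi>"

definition iff :: "form \<Rightarrow> form \<Rightarrow> form" where
  "iff \<phi> \<psi> = And (imp \<phi> \<psi>) (imp \<psi> \<phi>)"

text \<open>The grammar has no constants; falsum and verum abbreviate \<open>p \<and> \<not>p\<close> and
  \<open>\<not>p \<or> p\<close> for a fixed variable \<open>p\<close>.\<close>

definition falsum :: form where
  "falsum = And (Pos 0) (Neg 0)"

definition verum :: form where
  "verum = neg falsum"

text \<open>Simultaneous capture-avoiding substitution: a negative literal \<open>\<not>p\<close> is replaced by the
  negation of \<open>\<sigma> p\<close>.  Following Stoughton, every bound variable is renamed to the least variable
  that is not free in any formula substituted into its scope.  Results are thus representatives
  of the usual ones up to renaming of bound variables, chosen so that successive substitutions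
  compose literally.\<close>

primrec fsubst :: "(var \<Rightarrow> form) \<Rightarrow> form \<Rightarrow> form" where
  "fsubst \<sigma> (Pos p) = \<sigma> p"
| "fsubst \<sigma> (Neg p) = neg (\<sigma> p)"
| "fsubst \<sigma> (Or \<phi> \<psi>) = Or (fsubst \<sigma> \<phi>) (fsubst \<sigma> \<psi>)"
| "fsubst \<sigma> (And \<phi> \<psi>) = And (fsubst \<sigma> \<phi>) (fsubst \<sigma> \<psi>)"
| "fsubst \<sigma> (Dia \<phi>) = Dia (fsubst \<sigma> \<phi>)"
| "fsubst \<sigma> (Box \<phi>) = Box (fsubst \<sigma> \<phi>)"
| "fsubst \<sigma> (Mu x \<phi>) = (let y = (LEAST y. \<forall>z \<in> FV \<phi> - {x}. y \<notin> FV (\<sigma> z))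
                       in Mu y (fsubst (\<sigma>(x := Pos y)) \<phi>))"
| "fsubst \<sigma> (Nu x \<phi>) = (let y = (LEAST y. \<forall>z \<in> FV \<phi> - {x}. y \<notin> FV (\<sigma> z))
                       in Nu y (fsubst (\<sigma>(x := Pos y)) \<phi>))"

text \<open>\<open>subst1 \<phi> \<psi> x\<close> is \<open>\<phi>[\<psi>/x]\<close>.\<close>

definition subst1 :: "form \<Rightarrow> form \<Rightarrow> var \<Rightarrow> form" where
  "subst1 \<phi> \<psi> x = fsubst (Pos(x := \<psi>)) \<phi>"


section \<open>Kripke semantics\<close>

text \<open>A frame is given by an explicit carrier, so that one type \<open>'s\<close> hosts frames of all
  cardinalities up to its own.\<close>

type_synonym 's frame = "'s set \<times> ('s \<times> 's) set"

definition is_frame :: "'s frame \<Rightarrow> bool" where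
  "is_frame F \<longleftrightarrow> snd F \<subseteq> fst F \<times> fst F"

text \<open>Only the part of a valuation inside the carrier \<open>S\<close> matters.  Consequently all values of
  \<open>sem S R\<close> are subsets of \<open>S\<close>, and for monotone bodies the fixpoints below coincide with
  those taken in the powerset lattice of \<open>S\<close>.\<close>

primrec sem :: "'s set \<Rightarrow> ('s \<times> 's) set \<Rightarrow> (var \<Rightarrow> 's set) \<Rightarrow> form \<Rightarrow> 's set" where
  "sem S R V (Pos p) = S \<inter> V p"
| "sem S R V (Neg p) = S - V p"
| "sem S R V (Or \<phi> \<psi>) = sem S R V \<phi> \<union> sem S R V \<psi>"
| "sem S R V (And \<phi> \<psi>) = sem S R V \<phi> \<inter> sem S R V \<psi>"
| "sem S R V (Dia \<phi>) = {s \<in> S. \<exists>t. (s, t) \<in> R \<and> t \<in> sem S R V \<phi>}"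
| "sem S R V (Box \<phi>) = {s \<in> S. \<forall>t. (s, t) \<in> R \<longrightarrow> t \<in> sem S R V \<phi>}"
| "sem S R V (Mu x \<phi>) = lfp (\<lambda>U. sem S R (V(x := U)) \<phi>)"
| "sem S R V (Nu x \<phi>) = gfp (\<lambda>U. sem S R (V(x := U)) \<phi>)"

definition valid_in :: "'s frame \<Rightarrow> form \<Rightarrow> bool" where
  "valid_in F \<phi> \<longleftrightarrow> (\<forall>V. \<forall>s \<in> fst F. s \<in> sem (fst F) (snd F) V \<phi>)"

definition Fr :: "form set \<Rightarrow> 's frame set" where
  "Fr L = {F. is_frame F \<and> (\<forall>\<phi> \<in> L. valid_in F \<phi>)}"


section \<open>Logics\<close>

primrec propositional :: "form \<Rightarrow> bool" where
  "propositional (Pos p) = True"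
| "propositional (Neg p) = True"
| "propositional (Or \<phi> \<psi>) = (propositional \<phi> \<and> propositional \<psi>)"
| "propositional (And \<phi> \<psi>) = (propositional \<phi> \<and> propositional \<psi>)"
| "propositional (Dia \<phi>) = False"
| "propositional (Box \<phi>) = False"
| "propositional (Mu x \<phi>) = False"
| "propositional (Nu x \<phi>) = False"

text \<open>The values on non-propositional formulas are irrelevant.\<close>

primrec prop_eval :: "(var \<Rightarrow> bool) \<Rightarrow> form \<Rightarrow> bool" where
  "prop_eval v (Pos p) = v p"
| "prop_eval v (Neg p) = (\<not> v p)"
| "prop_eval v (Or \<phi> \<psi>) = (prop_eval v \<phi> \<or> prop_eval v \<psi>)"
| "prop_eval v (And \<phi> \<psi>) = (prop_eval v \<phi> \<and> prop_eval v \<psi>)"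
| "prop_eval v (Dia \<phi>) = False"
| "prop_eval v (Box \<phi>) = False"
| "prop_eval v (Mu x \<phi>) = False"
| "prop_eval v (Nu x \<phi>) = False"

definition tautology :: "form \<Rightarrow> bool" where
  "tautology \<phi> \<longleftrightarrow> propositional \<phi> \<and> (\<forall>v. prop_eval v \<phi>)"

text \<open>A normal modal logic need not be consistent.\<close>

definition normal_modal_logic :: "form set \<Rightarrow> bool" where
  "normal_modal_logic L \<longleftrightarrow>
     (\<forall>\<phi> \<in> L. basic \<phi>) \<and>
     (\<forall>\<phi>. tautology \<phi> \<longrightarrow> \<phi> \<in> L) \<and>
     (\<forall>p q. imp (Box (imp (Pos p) (Pos q))) (imp (Box (Pos p)) (Box (Pos q))) \<in> L) \<and>
     (\<forall>p. iff (Dia (Pos p)) (neg (Box (neg (Pos p)))) \<in> L) \<and>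
     (\<forall>\<phi> \<psi>. \<phi> \<in> L \<longrightarrow> imp \<phi> \<psi> \<in> L \<longrightarrow> \<psi> \<in> L) \<and>
     (\<forall>\<phi>. \<phi> \<in> L \<longrightarrow> Box \<phi> \<in> L) \<and>
     (\<forall>\<phi> \<sigma>. \<phi> \<in> L \<longrightarrow> (\<forall>p. basic (\<sigma> p)) \<longrightarrow> fsubst \<sigma> \<phi> \<in> L)"

text \<open>\<open>mu_c_logic L\<close> is the least \<open>\<mu>\<^sub>c\<close>-logic containing \<open>L\<close>; with
  \<open>L = {}\<close> it is \<open>\<mu>\<^sub>cK\<close>.  All propositional tautologies serve as the complete
  axiomatisation of propositional logic.\<close>

inductive_set mu_c_logic :: "form set \<Rightarrow> form set" for L :: "form set" where
  from_L: "\<phi> \<in> L \<Longrightarrow> \<phi> \<in> mu_c_logic L"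
| taut: "tautology \<phi> \<Longrightarrow> \<phi> \<in> mu_c_logic L"
| Dia_falsum: "neg (Dia falsum) \<in> mu_c_logic L"
| Box_verum: "Box verum \<in> mu_c_logic L"
| Dia_Or: "iff (Dia (Or (Pos p) (Pos q))) (Or (Dia (Pos p)) (Dia (Pos q))) \<in> mu_c_logic L"
| Box_And: "iff (Box (And (Pos p) (Pos q))) (And (Box (Pos p)) (Box (Pos q))) \<in> mu_c_logic L"
| Dia_dual: "iff (Dia (Pos p)) (neg (Box (neg (Pos p)))) \<in> mu_c_logic L"
| Mu_prefix: "Con {x} \<phi> \<Longrightarrow> imp (subst1 \<phi> (Mu x \<phi>) x) (Mu x \<phi>) \<in> mu_c_logic L"
| Nu_postfix: "Cocon {x} \<phi> \<Longrightarrow> imp (Nu x \<phi>) (subst1 \<phi> (Nu x \<phi>) x) \<in> mu_c_logic L"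
| Mu_dual: "Con {x} \<phi> \<Longrightarrow> iff (Mu x \<phi>) (neg (Nu x (neg (flip x \<phi>)))) \<in> mu_c_logic L"
| mp: "\<phi> \<in> mu_c_logic L \<Longrightarrow> imp \<phi> \<psi> \<in> mu_c_logic L \<Longrightarrow> \<psi> \<in> mu_c_logic L"
| Dia_mono: "imp \<phi> \<psi> \<in> mu_c_logic L \<Longrightarrow> imp (Dia \<phi>) (Dia \<psi>) \<in> mu_c_logic L"
| Box_mono: "imp \<phi> \<psi> \<in> mu_c_logic L \<Longrightarrow> imp (Box \<phi>) (Box \<psi>) \<in> mu_c_logic L"
| usubst: "\<phi> \<in> mu_c_logic L \<Longrightarrow> (\<And>p. mu_c (\<sigma> p)) \<Longrightarrow> fsubst \<sigma> \<phi> \<in> mu_c_logic L"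
| Mu_least: "Con {x} \<phi> \<Longrightarrow> imp (subst1 \<phi> \<gamma> x) \<gamma> \<in> mu_c_logic L \<Longrightarrow>
    imp (Mu x \<phi>) \<gamma> \<in> mu_c_logic L"
| Nu_greatest: "Cocon {x} \<phi> \<Longrightarrow> imp \<gamma> (subst1 \<phi> \<gamma> x) \<in> mu_c_logic L \<Longrightarrow>
    imp \<gamma> (Nu x \<phi>) \<in> mu_c_logic L"


section \<open>Canonicity\<close>

definition consistent :: "form set \<Rightarrow> form set \<Rightarrow> bool" where
  "consistent L \<Gamma> \<longleftrightarrow> (\<forall>\<gamma>s. set \<gamma>s \<subseteq> \<Gamma> \<longrightarrow> neg (foldr And \<gamma>s verum) \<notin> L)"

definition max_consistent :: "form set \<Rightarrow> form set \<Rightarrow> bool" where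
  "max_consistent L \<Gamma> \<longleftrightarrow>
     \<Gamma> \<subseteq> Collect basic \<and> consistent L \<Gamma> \<and>
     (\<forall>\<Delta>. \<Gamma> \<subset> \<Delta> \<longrightarrow> \<Delta> \<subseteq> Collect basic \<longrightarrow> \<not> consistent L \<Delta>)"

definition canonical_frame :: "form set \<Rightarrow> form set frame" where
  "canonical_frame L =
     ({\<Gamma>. max_consistent L \<Gamma>},
      {(\<Gamma>, \<Delta>). max_consistent L \<Gamma> \<and> max_consistent L \<Delta> \<and>
                (\<forall>\<phi>. Box \<phi> \<in> \<Gamma> \<longrightarrow> \<phi> \<in> \<Delta>)})"

definition canonical :: "form set \<Rightarrow> bool" where
  "canonical L \<longleftrightarrow> canonical_frame L \<in> Fr L"


section \<open>Filtration\<close>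

definition FL_closed :: "form set \<Rightarrow> bool" where
  "FL_closed \<Sigma> \<longleftrightarrow>
     (\<forall>p. Neg p \<in> \<Sigma> \<longrightarrow> Pos p \<in> \<Sigma>) \<and>
     (\<forall>\<phi> \<psi>. Or \<phi> \<psi> \<in> \<Sigma> \<longrightarrow> \<phi> \<in> \<Sigma> \<and> \<psi> \<in> \<Sigma>) \<and>
     (\<forall>\<phi> \<psi>. And \<phi> \<psi> \<in> \<Sigma> \<longrightarrow> \<phi> \<in> \<Sigma> \<and> \<psi> \<in> \<Sigma>) \<and>
     (\<forall>\<phi>. Dia \<phi> \<in> \<Sigma> \<longrightarrow> \<phi> \<in> \<Sigma>) \<and>
     (\<forall>\<phi>. Box \<phi> \<in> \<Sigma> \<longrightarrow> \<phi> \<in> \<Sigma>) \<and>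
     (\<forall>x \<phi>. Mu x \<phi> \<in> \<Sigma> \<longrightarrow> subst1 \<phi> (Mu x \<phi>) x \<in> \<Sigma>) \<and>
     (\<forall>x \<phi>. Nu x \<phi> \<in> \<Sigma> \<longrightarrow> subst1 \<phi> (Nu x \<phi>) x \<in> \<Sigma>)"

definition fequiv ::
    "'s set \<Rightarrow> ('s \<times> 's) set \<Rightarrow> (var \<Rightarrow> 's set) \<Rightarrow> form set \<Rightarrow> ('s \<times> 's) set" where
  "fequiv S R V \<Sigma> =
     {(s, t). s \<in> S \<and> t \<in> S \<and> (\<forall>\<phi> \<in> \<Sigma>. s \<in> sem S R V \<phi> \<longleftrightarrow> t \<in> sem S R V \<phi>)}"

definition Rmin ::
    "'s set \<Rightarrow> ('s \<times> 's) set \<Rightarrow> (var \<Rightarrow> 's set) \<Rightarrow> form set \<Rightarrow> ('s set \<times> 's set) set" where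
  "Rmin S R V \<Sigma> =
     {(fequiv S R V \<Sigma> `` {s}, fequiv S R V \<Sigma> `` {t}) | s t.
        s \<in> S \<and> t \<in> S \<and>
        (\<exists>s' t'. (s, s') \<in> fequiv S R V \<Sigma> \<and> (t, t') \<in> fequiv S R V \<Sigma> \<and> (s', t') \<in> R)}"

definition Rmax ::
    "'s set \<Rightarrow> ('s \<times> 's) set \<Rightarrow> (var \<Rightarrow> 's set) \<Rightarrow> form set \<Rightarrow> ('s set \<times> 's set) set" where
  "Rmax S R V \<Sigma> =
     {(fequiv S R V \<Sigma> `` {s}, fequiv S R V \<Sigma> `` {t}) | s t.
        s \<in> S \<and> t \<in> S \<and>
        (\<forall>\<phi>. Box \<phi> \<in> \<Sigma> \<longrightarrow> s \<in> sem S R V (Box \<phi>) \<longrightarrow> t \<in> sem S R V \<phi>)}"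

definition is_filtration ::
    "'s set \<Rightarrow> ('s \<times> 's) set \<Rightarrow> (var \<Rightarrow> 's set) \<Rightarrow> form set \<Rightarrow>
     's set set \<Rightarrow> ('s set \<times> 's set) set \<Rightarrow> (var \<Rightarrow> 's set set) \<Rightarrow> bool" where
  "is_filtration S R V \<Sigma> S' R' V' \<longleftrightarrow>
     S' = S // fequiv S R V \<Sigma> \<and>
     Rmin S R V \<Sigma> \<subseteq> R' \<and> R' \<subseteq> Rmax S R V \<Sigma> \<and>
     (\<forall>p. V' p \<subseteq> S') \<and>
     (\<forall>p. Pos p \<in> \<Sigma> \<longrightarrow>
        V' p = {fequiv S R V \<Sigma> `` {s} | s. s \<in> S \<and> s \<in> sem S R V (Pos p)})"

text \<open>The states of a filtration are sets of states of the original model, so a class of frames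
  enters at the two state types \<open>'s\<close> and \<open>'s set\<close>: \<open>\<F>\<close> and \<open>\<F>'\<close> are meant to be instances
  of one and the same polymorphic class, such as \<open>Fr L\<close>.\<close>

definition admits_filtration :: "'s frame set \<Rightarrow> 's set frame set \<Rightarrow> bool" where
  "admits_filtration \<F> \<F>' \<longleftrightarrow>
     (\<forall>S R V \<Sigma>. (S, R) \<in> \<F> \<longrightarrow> finite \<Sigma> \<longrightarrow> FL_closed \<Sigma> \<longrightarrow> (\<forall>\<phi> \<in> \<Sigma>. basic \<phi>) \<longrightarrow>
        (\<exists>S' R' V'. is_filtration S R V \<Sigma> S' R' V' \<and> (S', R') \<in> \<F>'))"

end

(* Soundness is routine. For completeness, a substitution of all formulas of the fixpoint language
   for variables turns the fixpoint logic into an L-theory T of basic formulas, so that the maximal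
   consistent sets containing T form a generated subframe of the canonical frame of L, which
   therefore validates L. The given filtration is applied to this model and to finitely many formulas
   p, ~p, []p, []~p, where p stands for a formula met when unravelling the non-theorem.

   The truth lemma for fixpoint formulas is then proved directly on the finite quotient: a formula
   mu x. phi in a maximal consistent set is true at its class because the least fixpoint U computed in
   the quotient is defined by some formula gamma, and the induction rule applies to gamma as soon as
   phi[gamma/x] -> gamma is provable. That is, membership of phi[gamma/x] must imply truth of phi at
   x := U, although gamma lies outside the filtration set; for continuous phi this only uses that
   the quotient map preserves the accessibility relation. *)

theory Submission
  imports Defs "HOL-Library.Countable"
begin

section \<open>Negation and substitution\<close>

text \<open>Canonicity and filtration speak of basic formulas only, but the non-theorem contains
  fixpoints. Letting each variable name a formula of the fixpoint language keeps the worlds inside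
  the canonical frame of L and lets a fixpoint formula enter a filtration set as a mere letter.

  The obstacle is that the quotient may carry any relation between the minimal and the maximal one,
  so it reflects modalities only for formulas named in the filtration set. Once a variable stands
  for the defining formula of a set of classes, half of the truth lemma is lost. The half that
  survives under diamonds is the one demanded by the rule for least fixpoints; the half that
  survives under boxes is the one demanded by the rule for greatest fixpoints. Hence the induction
  carries a one-sided statement for \<open>Con\<close> and another for \<open>Cocon\<close> beside
  the full truth lemma.

  Substitution renames bound variables, so the argument is confined to formulas fixed by
  \<open>fsubst Pos\<close>. The states of a quotient are sets of states, so it is copied back into
  the original type before validity is applied.\<close>

lemma finite_FV [simp]: "finite (FV \<phi>)"
  by (induction \<phi>) auto

text \<open>Negating nested binders piles up flips of several variables. For sets of variables they
  compose by symmetric difference, which a family of single flips does not express.\<close>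

primrec flips :: "var set \<Rightarrow> form \<Rightarrow> form" where
  "flips X (Pos p) = (if p \<in> X then Neg p else Pos p)"
| "flips X (Neg p) = (if p \<in> X then Pos p else Neg p)"
| "flips X (Or \<phi> \<psi>) = Or (flips X \<phi>) (flips X \<psi>)"
| "flips X (And \<phi> \<psi>) = And (flips X \<phi>) (flips X \<psi>)"
| "flips X (Dia \<phi>) = Dia (flips X \<phi>)"
| "flips X (Box \<phi>) = Box (flips X \<phi>)"
| "flips X (Mu y \<phi>) = Mu y (flips (X - {y}) \<phi>)"
| "flips X (Nu y \<phi>) = Nu y (flips (X - {y}) \<phi>)"

lemma flips_disjoint: "FV \<phi> \<inter> X = {} \<Longrightarrow> flips X \<phi> = \<phi>"
proof (induction \<phi> arbitrary: X)
  case (Mu y \<phi>)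
  have "FV \<phi> \<inter> (X - {y}) = {}" using Mu.prems by auto
  then show ?case using Mu.IH by simp
next
  case (Nu y \<phi>)
  have "FV \<phi> \<inter> (X - {y}) = {}" using Nu.prems by auto
  then show ?case using Nu.IH by simp
qed (auto simp: Int_Un_distrib2)

lemma flip_eq_flips: "flip x \<phi> = flips {x} \<phi>"
  by (induction \<phi>) (auto simp: flips_disjoint)

lemma FV_flips [simp]: "FV (flips X \<phi>) = FV \<phi>"
  by (induction \<phi> arbitrary: X) auto

lemma FV_neg [simp]: "FV (neg \<phi>) = FV \<phi>"
  by (induction \<phi>) (auto simp: flip_eq_flips)

lemma flips_flips: "flips X (flips Y \<phi>) = flips ((X - Y) \<union> (Y - X)) \<phi>"
proof (induction \<phi> arbitrary: X Y)
  case (Mu y \<phi>)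
  have "(X - {y} - (Y - {y})) \<union> (Y - {y} - (X - {y})) = (X - Y \<union> (Y - X)) - {y}" by auto
  then show ?case by (simp add: Mu)
next
  case (Nu y \<phi>)
  have "(X - {y} - (Y - {y})) \<union> (Y - {y} - (X - {y})) = (X - Y \<union> (Y - X)) - {y}" by auto
  then show ?case by (simp add: Nu)
qed auto

text \<open>At a binder \<open>neg\<close> adds a flip of its own; the two flips commute because
  symmetric difference is commutative.\<close>

lemma neg_flips: "neg (flips X \<phi>) = flips X (neg \<phi>)"
proof (induction \<phi> arbitrary: X)
  case (Mu y \<phi>)
  have "{y} - (X - {y}) \<union> (X - {y} - {y}) = X - {y} - {y} \<union> ({y} - (X - {y}))" by auto
  then show ?case by (simp add: Mu flip_eq_flips flips_flips)
next
  case (Nu y \<phi>)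
  have "{y} - (X - {y}) \<union> (X - {y} - {y}) = X - {y} - {y} \<union> ({y} - (X - {y}))" by auto
  then show ?case by (simp add: Nu flip_eq_flips flips_flips)
qed auto

lemma neg_neg [simp]: "neg (neg \<phi>) = \<phi>"
  by (induction \<phi>) (auto simp: flip_eq_flips neg_flips flips_flips flips_disjoint)

section \<open>Simultaneous substitution: fresh binders, negation, composition\<close>

abbreviation fresh :: "(var \<Rightarrow> form) \<Rightarrow> form \<Rightarrow> var \<Rightarrow> var" where
  "fresh \<sigma> \<phi> x \<equiv> (LEAST y. \<forall>z \<in> FV \<phi> - {x}. y \<notin> FV (\<sigma> z))"

lemma fresh:
  assumes "z \<in> FV \<phi> - {x}"
  shows "fresh \<sigma> \<phi> x \<notin> FV (\<sigma> z)"
proof -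
  have "finite (\<Union>z \<in> FV \<phi> - {x}. FV (\<sigma> z))" by simp
  then obtain y where "y \<notin> (\<Union>z \<in> FV \<phi> - {x}. FV (\<sigma> z))"
    using ex_new_if_finite infinite_UNIV_nat by blast
  then have "\<forall>z \<in> FV \<phi> - {x}. y \<notin> FV (\<sigma> z)" by blast
  then have "\<forall>z \<in> FV \<phi> - {x}. fresh \<sigma> \<phi> x \<notin> FV (\<sigma> z)" by (rule LeastI)
  then show ?thesis using assms by blast
qed

lemma fsubst_Mu: "fsubst \<sigma> (Mu x \<phi>) = Mu (fresh \<sigma> \<phi> x) (fsubst (\<sigma>(x := Pos (fresh \<sigma> \<phi> x))) \<phi>)"
  and fsubst_Nu: "fsubst \<sigma> (Nu x \<phi>) = Nu (fresh \<sigma> \<phi> x) (fsubst (\<sigma>(x := Pos (fresh \<sigma> \<phi> x))) \<phi>)"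
  by (simp_all add: Let_def)

lemma fsubst_cong: "(\<And>z. z \<in> FV \<phi> \<Longrightarrow> \<sigma> z = \<tau> z) \<Longrightarrow> fsubst \<sigma> \<phi> = fsubst \<tau> \<phi>"
proof (induction \<phi> arbitrary: \<sigma> \<tau>)
  case (Or \<phi> \<psi>)
  then show ?case by (metis FV.simps(3) UnCI fsubst.simps(3))
next
  case (And \<phi> \<psi>)
  then show ?case by (metis FV.simps(4) UnCI fsubst.simps(4))
next
  case (Mu x \<phi>)
  have "fresh \<sigma> \<phi> x = fresh \<tau> \<phi> x" using Mu.prems by simp
  moreover have "fsubst (\<sigma>(x := Pos y)) \<phi> = fsubst (\<tau>(x := Pos y)) \<phi>" for y
    using Mu.prems by (intro Mu.IH) auto
  ultimately show ?case by (simp add: Let_def)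
next
  case (Nu x \<phi>)
  have "fresh \<sigma> \<phi> x = fresh \<tau> \<phi> x" using Nu.prems by simp
  moreover have "fsubst (\<sigma>(x := Pos y)) \<phi> = fsubst (\<tau>(x := Pos y)) \<phi>" for y
    using Nu.prems by (intro Nu.IH) auto
  ultimately show ?case by (simp add: Let_def)
next
  case (Dia \<phi>)
  show ?case unfolding fsubst.simps by (rule arg_cong[OF Dia.IH]) (simp add: Dia.prems)
next
  case (Box \<phi>)
  show ?case unfolding fsubst.simps by (rule arg_cong[OF Box.IH]) (simp add: Box.prems)
qed simp_all

lemma FV_fsubst_binder:
  assumes "\<And>\<sigma>. FV (fsubst \<sigma> \<phi>) = (\<Union>z \<in> FV \<phi>. FV (\<sigma> z))"
  shows "FV (fsubst (\<sigma>(x := Pos (fresh \<sigma> \<phi> x))) \<phi>) - {fresh \<sigma> \<phi> x} = (\<Union>z \<in> FV \<phi> - {x}. FV (\<sigma> z))"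
  using fresh[of _ \<phi> x \<sigma>] unfolding assms by (auto split: if_splits)

lemma FV_fsubst: "FV (fsubst \<sigma> \<phi>) = (\<Union>z \<in> FV \<phi>. FV (\<sigma> z))"
proof (induction \<phi> arbitrary: \<sigma>)
  case (Mu x \<phi>)
  show ?case unfolding fsubst_Mu FV.simps FV_fsubst_binder[OF Mu] ..
next
  case (Nu x \<phi>)
  show ?case unfolding fsubst_Nu FV.simps FV_fsubst_binder[OF Nu] ..
qed auto

lemma fsubst_flips:
  "fsubst \<tau> (flips X \<phi>) = fsubst (\<lambda>z. if z \<in> X then neg (\<tau> z) else \<tau> z) \<phi>"
proof (induction \<phi> arbitrary: X \<tau>)
  case (Mu y \<phi>)
  let ?n = "\<lambda>X \<tau> z. if z \<in> X then neg (\<tau> z) else \<tau> z"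
  have f: "fresh \<tau> (flips (X - {y}) \<phi>) y = fresh (?n X \<tau>) \<phi> y"
    by (rule arg_cong[where f = Least]) auto
  have "?n (X - {y}) (\<tau>(y := Pos w)) = (?n X \<tau>)(y := Pos w)" for w by auto
  then show ?case by (simp add: Let_def f Mu del: fun_upd_apply)
next
  case (Nu y \<phi>)
  let ?n = "\<lambda>X \<tau> z. if z \<in> X then neg (\<tau> z) else \<tau> z"
  have f: "fresh \<tau> (flips (X - {y}) \<phi>) y = fresh (?n X \<tau>) \<phi> y"
    by (rule arg_cong[where f = Least]) auto
  have "?n (X - {y}) (\<tau>(y := Pos w)) = (?n X \<tau>)(y := Pos w)" for w by auto
  then show ?case by (simp add: Let_def f Nu del: fun_upd_apply)
qed auto

lemma flips_fsubst: "flips X (fsubst \<tau> \<phi>) = fsubst (flips X \<circ> \<tau>) \<phi>"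
proof (induction \<phi> arbitrary: X \<tau>)
  case (Mu y \<phi>)
  let ?w = "fresh \<tau> \<phi> y"
  have "flips (X - {?w}) (fsubst (\<tau>(y := Pos ?w)) \<phi>)
      = fsubst (flips (X - {?w}) \<circ> \<tau>(y := Pos ?w)) \<phi>" by (rule Mu)
  also have "\<dots> = fsubst ((flips X \<circ> \<tau>)(y := Pos ?w)) \<phi>"
  proof (rule fsubst_cong)
    fix z assume z: "z \<in> FV \<phi>"
    show "(flips (X - {?w}) \<circ> \<tau>(y := Pos ?w)) z = ((flips X \<circ> \<tau>)(y := Pos ?w)) z"
    proof (cases "z = y")
      case False
      then have "?w \<notin> FV (\<tau> z)" using z by (intro fresh) auto
      then have "flips {?w} (\<tau> z) = \<tau> z" by (intro flips_disjoint) auto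
      \<comment> \<open>Where \<open>?w\<close> does not occur free, flipping it changes nothing, so
        removing it from X is harmless.\<close>
      then have "flips (X - {?w}) (\<tau> z) = flips X (\<tau> z)"
        using flips_flips[of X "{?w}" "\<tau> z"] flips_flips[of "X - {?w}" "{?w}" "\<tau> z"]
        by (cases "?w \<in> X") auto
      then show ?thesis using False by simp
    qed simp
  qed
  finally show ?case by (simp add: Let_def o_def)
next
  case (Nu y \<phi>)
  let ?w = "fresh \<tau> \<phi> y"
  have "flips (X - {?w}) (fsubst (\<tau>(y := Pos ?w)) \<phi>)
      = fsubst (flips (X - {?w}) \<circ> \<tau>(y := Pos ?w)) \<phi>" by (rule Nu)
  also have "\<dots> = fsubst ((flips X \<circ> \<tau>)(y := Pos ?w)) \<phi>"
  proof (rule fsubst_cong)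
    fix z assume z: "z \<in> FV \<phi>"
    show "(flips (X - {?w}) \<circ> \<tau>(y := Pos ?w)) z = ((flips X \<circ> \<tau>)(y := Pos ?w)) z"
    proof (cases "z = y")
      case False
      then have "?w \<notin> FV (\<tau> z)" using z by (intro fresh) auto
      then have "flips {?w} (\<tau> z) = \<tau> z" by (intro flips_disjoint) auto
      then have "flips (X - {?w}) (\<tau> z) = flips X (\<tau> z)"
        using flips_flips[of X "{?w}" "\<tau> z"] flips_flips[of "X - {?w}" "{?w}" "\<tau> z"]
        by (cases "?w \<in> X") auto
      then show ?thesis using False by simp
    qed simp
  qed
  finally show ?case by (simp add: Let_def o_def)
qed (auto simp: neg_flips)

lemma neg_fsubst: "neg (fsubst \<sigma> \<phi>) = fsubst \<sigma> (neg \<phi>)"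
proof -
  \<comment> \<open>The chosen w is not free in the values of the other variables, so flipping it
    after the substitution affects exactly the places that held x.\<close>
  have body: "flip w (fsubst (\<sigma>(x := Pos w)) \<phi>) = fsubst (\<sigma>(x := Pos w)) (flip x \<phi>)"
    if "w = fresh \<sigma> \<phi> x" for \<sigma> x w \<phi>
  proof -
    have "flips {w} (\<sigma> z) = \<sigma> z" if "z \<in> FV \<phi>" "z \<noteq> x" for z
      using fresh[of z \<phi> x \<sigma>] that \<open>w = _\<close> by (intro flips_disjoint) auto
    then show ?thesis
      unfolding flip_eq_flips flips_fsubst fsubst_flips by (intro fsubst_cong) auto
  qed
  show ?thesis
  proof (induction \<phi> arbitrary: \<sigma>)
    case (Mu x \<phi>)
    show ?case using body[where w = "fresh \<sigma> \<phi> x" and \<sigma> = \<sigma> and \<phi> = "neg \<phi>" and x = x] Mu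
      by (simp add: Let_def flip_eq_flips del: fun_upd_apply)
  next
    case (Nu x \<phi>)
    show ?case using body[where w = "fresh \<sigma> \<phi> x" and \<sigma> = \<sigma> and \<phi> = "neg \<phi>" and x = x] Nu
      by (simp add: Let_def flip_eq_flips del: fun_upd_apply)
  qed auto
qed

text \<open>Composition is an equality of formulas rather than of renaming classes because the bound
  variable chosen depends only on the free variables substituted into the scope, and these agree on
  both sides (\<open>fr\<close>).\<close>

lemma fsubst_fsubst: "fsubst \<sigma> (fsubst \<tau> \<phi>) = fsubst (fsubst \<sigma> \<circ> \<tau>) \<phi>"
proof -
  have fr: "fresh \<sigma> (fsubst (\<tau>(x := Pos (fresh \<tau> \<phi> x))) \<phi>) (fresh \<tau> \<phi> x)
      = fresh (fsubst \<sigma> \<circ> \<tau>) \<phi> x" for \<sigma> \<tau> \<phi> x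
    unfolding FV_fsubst_binder[OF FV_fsubst] by (simp add: FV_fsubst)
  have body: "fsubst (fsubst (\<sigma>(y := Pos w)) \<circ> \<tau>(x := Pos y)) \<phi> = fsubst ((fsubst \<sigma> \<circ> \<tau>)(x := Pos w)) \<phi>"
    if y: "y = fresh \<tau> \<phi> x" for \<sigma> \<tau> \<phi> x w y
  proof (rule fsubst_cong)
    fix z assume z: "z \<in> FV \<phi>"
    show "(fsubst (\<sigma>(y := Pos w)) \<circ> \<tau>(x := Pos y)) z = ((fsubst \<sigma> \<circ> \<tau>)(x := Pos w)) z"
    proof (cases "z = x")
      case False
      then have "y \<notin> FV (\<tau> z)" using fresh[of z \<phi> x \<tau>] z y by auto
      then have "fsubst (\<sigma>(y := Pos w)) (\<tau> z) = fsubst \<sigma> (\<tau> z)" by (intro fsubst_cong) auto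
      then show ?thesis using False by simp
    qed simp
  qed
  show ?thesis
  proof (induction \<phi> arbitrary: \<sigma> \<tau>)
    case (Mu x \<phi>)
    show ?case unfolding fsubst_Mu fr Mu body[OF refl] ..
  next
    case (Nu x \<phi>)
    show ?case unfolding fsubst_Nu fr Nu body[OF refl] ..
  qed (auto simp: neg_fsubst)
qed

lemma fsubst_imp [simp]: "fsubst \<sigma> (imp \<phi> \<psi>) = imp (fsubst \<sigma> \<phi>) (fsubst \<sigma> \<psi>)"
  by (simp add: imp_def neg_fsubst)

text \<open>Substitutions rename bound variables, so \<open>fsubst Pos\<close> is not the identity but a normal form
  for renaming; \<open>canon\<close> collects its fixed points.\<close>

definition canon :: "form \<Rightarrow> bool" where
  "canon \<phi> \<longleftrightarrow> mu_c \<phi> \<and> fsubst Pos \<phi> = \<phi>"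

text \<open>Turns the unfolding of a fixpoint formula into an update of the environment
  \<open>\<delta>\<close>. The truth lemma can therefore recurse on \<phi> itself and never on
  unfolded formulas. The assumption is there because substituting nothing still renames.\<close>

lemma unfold_binder:
  assumes "\<And>z. z \<in> FV \<phi> - {x} \<Longrightarrow> fsubst Pos (\<delta> z) = \<delta> z"
  shows "subst1 (fsubst (\<delta>(x := Pos (fresh \<delta> \<phi> x))) \<phi>) \<gamma> (fresh \<delta> \<phi> x) = fsubst (\<delta>(x := \<gamma>)) \<phi>"
  unfolding subst1_def fsubst_fsubst
proof (rule fsubst_cong)
  fix z assume z: "z \<in> FV \<phi>"
  let ?w = "fresh \<delta> \<phi> x"
  show "(fsubst (Pos(?w := \<gamma>)) \<circ> \<delta>(x := Pos ?w)) z = (\<delta>(x := \<gamma>)) z"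
  proof (cases "z = x")
    case False
    then have "?w \<notin> FV (\<delta> z)" using z by (intro fresh) auto
    then have "fsubst (Pos(?w := \<gamma>)) (\<delta> z) = fsubst Pos (\<delta> z)" by (intro fsubst_cong) auto
    then show ?thesis using False z assms by simp
  qed simp
qed

section \<open>Closure properties of the continuous fragment\<close>

lemma Con_antimono: "Con X \<phi> \<Longrightarrow> Y \<subseteq> X \<Longrightarrow> Con Y \<phi>"
  and Cocon_antimono: "Cocon X \<phi> \<Longrightarrow> Y \<subseteq> X \<Longrightarrow> Cocon Y \<phi>"
proof (induction arbitrary: Y and Y rule: mu_c_Con_Cocon.inducts(2,3)[where ?P1.0 = "\<lambda>_. True"])
  case (Con_var x X)
  then show ?case by (cases "x \<in> Y") (auto intro: mu_c_Con_Cocon.intros)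
next
  case (Con_free \<phi> X)
  then show ?case by (blast intro: mu_c_Con_Cocon.intros)
next
  case (Con_Mu X y \<phi>)
  then show ?case by (intro mu_c_Con_Cocon.Con_Mu) (metis Un_mono order_refl)
next
  case (Cocon_var x X)
  then show ?case by (cases "x \<in> Y") (auto intro: mu_c_Con_Cocon.intros)
next
  case (Cocon_free \<phi> X)
  then show ?case by (blast intro: mu_c_Con_Cocon.intros)
next
  case (Cocon_Nu X y \<phi>)
  then show ?case by (intro mu_c_Con_Cocon.Cocon_Nu) (metis Un_mono order_refl)
qed (auto intro: mu_c_Con_Cocon.intros)

lemma Con_singleton: "Con (X \<union> {y}) \<phi> \<Longrightarrow> Con {y} \<phi>"
  and Cocon_singleton: "Cocon (X \<union> {y}) \<phi> \<Longrightarrow> Cocon {y} \<phi>"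
  by (auto elim: Con_antimono Cocon_antimono)

lemma Con_mu_c: "Con X \<phi> \<Longrightarrow> mu_c \<phi>"
  and Cocon_mu_c: "Cocon X \<phi> \<Longrightarrow> mu_c \<phi>"
  by (induction rule: mu_c_Con_Cocon.inducts(2,3)[where ?P1.0 = "\<lambda>_. True"])
    (blast intro: mu_c_Con_Cocon.intros dest: Con_singleton Cocon_singleton)+

text \<open>Negation turns the variables in X into negative literals, which the dual grammar
  forbids; flipping X makes them positive again.\<close>

lemma mu_c_neg: "mu_c \<phi> \<Longrightarrow> mu_c (neg \<phi>)"
  and Con_neg: "Con X \<phi> \<Longrightarrow> Cocon X (flips X (neg \<phi>))"
  and Cocon_neg: "Cocon X \<phi> \<Longrightarrow> Con X (flips X (neg \<phi>))"
proof (induction rule: mu_c_Con_Cocon.inducts)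
  case (Con_Mu X y \<phi>)
  have "X - {y} - {y} \<union> ({y} - (X - {y})) = X \<union> {y}" by auto
  with Con_Mu show ?case by (auto simp: flip_eq_flips flips_flips intro!: mu_c_Con_Cocon.Cocon_Nu)
next
  case (Cocon_Nu X y \<phi>)
  have "X - {y} - {y} \<union> ({y} - (X - {y})) = X \<union> {y}" by auto
  with Cocon_Nu show ?case by (auto simp: flip_eq_flips flips_flips intro!: mu_c_Con_Cocon.Con_Mu)
next
  case (Con_free \<phi> X)
  then show ?case by (simp add: flips_disjoint mu_c_Con_Cocon.Cocon_free)
next
  case (Cocon_free \<phi> X)
  then show ?case by (simp add: flips_disjoint mu_c_Con_Cocon.Con_free)
qed (auto simp: flip_eq_flips intro: mu_c_Con_Cocon.intros)

text \<open>The side conditions describe what a substitution does beneath a renamed binder: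
  distinguished variables become distinguished variables, and all other values avoid these.\<close>

lemma mu_c_fsubst: "mu_c \<phi> \<Longrightarrow> (\<And>z. mu_c (\<delta> z)) \<Longrightarrow> mu_c (fsubst \<delta> \<phi>)"
  and Con_fsubst: "Con X \<phi> \<Longrightarrow> (\<And>z. mu_c (\<delta> z)) \<Longrightarrow>
      (\<And>x. x \<in> FV \<phi> \<inter> X \<Longrightarrow> \<exists>y \<in> Y. \<delta> x = Pos y) \<Longrightarrow>
      (\<And>z. z \<in> FV \<phi> - X \<Longrightarrow> FV (\<delta> z) \<inter> Y = {}) \<Longrightarrow> Con Y (fsubst \<delta> \<phi>)"
  and Cocon_fsubst: "Cocon X \<phi> \<Longrightarrow> (\<And>z. mu_c (\<delta> z)) \<Longrightarrow>
      (\<And>x. x \<in> FV \<phi> \<inter> X \<Longrightarrow> \<exists>y \<in> Y. \<delta> x = Pos y) \<Longrightarrow>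
      (\<And>z. z \<in> FV \<phi> - X \<Longrightarrow> FV (\<delta> z) \<inter> Y = {}) \<Longrightarrow> Cocon Y (fsubst \<delta> \<phi>)"
proof (induction arbitrary: \<delta> and \<delta> Y and \<delta> Y rule: mu_c_Con_Cocon.inducts)
  case (mu_c_Mu x \<phi>)
  show ?case unfolding fsubst_Mu
    by (rule mu_c_Con_Cocon.mu_c_Mu, rule mu_c_Mu.IH)
      (use mu_c_Mu.prems fresh[of _ \<phi> x \<delta>] in \<open>auto intro: mu_c_Con_Cocon.intros\<close>)
next
  case (mu_c_Nu x \<phi>)
  show ?case unfolding fsubst_Nu
    by (rule mu_c_Con_Cocon.mu_c_Nu, rule mu_c_Nu.IH)
      (use mu_c_Nu.prems fresh[of _ \<phi> x \<delta>] in \<open>auto intro: mu_c_Con_Cocon.intros\<close>)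
next
  case (Con_var x X)
  then show ?case by (fastforce intro: mu_c_Con_Cocon.intros)
next
  case (Con_free \<phi> X)
  then show ?case by (intro mu_c_Con_Cocon.Con_free) (fastforce simp: FV_fsubst)+
next
  case (Con_Mu X y \<phi>)
  show ?case unfolding fsubst_Mu
    by (rule mu_c_Con_Cocon.Con_Mu, rule Con_Mu.IH)
      (use Con_Mu.prems fresh[of _ \<phi> y \<delta>] in \<open>auto intro: mu_c_Con_Cocon.intros\<close>)
next
  case (Cocon_var x X)
  then show ?case by (fastforce intro: mu_c_Con_Cocon.intros)
next
  case (Cocon_free \<phi> X)
  then show ?case by (intro mu_c_Con_Cocon.Cocon_free) (fastforce simp: FV_fsubst)+
next
  case (Cocon_Nu X y \<phi>)
  show ?case unfolding fsubst_Nu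
    by (rule mu_c_Con_Cocon.Cocon_Nu, rule Cocon_Nu.IH)
      (use Cocon_Nu.prems fresh[of _ \<phi> y \<delta>] in \<open>auto intro: mu_c_Con_Cocon.intros\<close>)
qed (auto intro: mu_c_Con_Cocon.intros mu_c_neg)

lemma canon_fsubst: "mu_c \<phi> \<Longrightarrow> (\<And>z. canon (\<delta> z)) \<Longrightarrow> canon (fsubst \<delta> \<phi>)"
  by (simp add: canon_def mu_c_fsubst fsubst_fsubst o_def)


section \<open>Soundness\<close>

lemma sem_subset: "sem S R V \<phi> \<subseteq> S"
proof (induction \<phi> arbitrary: V)
  case (Mu x \<phi>)
  show ?case by (simp add: Mu lfp_lowerbound)
next
  case (Nu x \<phi>)
  show ?case unfolding sem.simps by (rule gfp_least) (use Nu in blast)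
qed auto

lemma sem_cong:
  "(\<And>z. z \<in> FV \<phi> \<Longrightarrow> S \<inter> V z = S \<inter> V' z) \<Longrightarrow> sem S R V \<phi> = sem S R V' \<phi>"
proof (induction \<phi> arbitrary: V V')
  case (Neg p)
  then show ?case by auto
next
  case (Or \<phi> \<psi>)
  have "sem S R V \<phi> = sem S R V' \<phi>" by (rule Or.IH(1)) (simp add: Or.prems)
  moreover have "sem S R V \<psi> = sem S R V' \<psi>" by (rule Or.IH(2)) (simp add: Or.prems)
  ultimately show ?case by simp
next
  case (And \<phi> \<psi>)
  have "sem S R V \<phi> = sem S R V' \<phi>" by (rule And.IH(1)) (simp add: And.prems)
  moreover have "sem S R V \<psi> = sem S R V' \<psi>" by (rule And.IH(2)) (simp add: And.prems)
  ultimately show ?case by simp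
next
  case (Dia \<phi>)
  have "sem S R V \<phi> = sem S R V' \<phi>" by (rule Dia.IH) (simp add: Dia.prems)
  then show ?case by simp
next
  case (Box \<phi>)
  have "sem S R V \<phi> = sem S R V' \<phi>" by (rule Box.IH) (simp add: Box.prems)
  then show ?case by simp
next
  case (Mu x \<phi>)
  have "sem S R (V(x := U)) \<phi> = sem S R (V'(x := U)) \<phi>" for U
    by (rule Mu.IH) (simp add: Mu.prems)
  then show ?case by simp
next
  case (Nu x \<phi>)
  have "sem S R (V(x := U)) \<phi> = sem S R (V'(x := U)) \<phi>" for U
    by (rule Nu.IH) (simp add: Nu.prems)
  then show ?case by simp
qed auto

section \<open>Semantics of negation and substitution\<close>

lemma sem_upd_Int: "sem S R (V(x := S \<inter> U)) \<phi> = sem S R (V(x := U)) \<phi>"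
  by (rule sem_cong) auto

lemma sem_flips:
  "sem S R V (flips X \<phi>) = sem S R (\<lambda>z. if z \<in> X then S - V z else V z) \<phi>"
proof (induction \<phi> arbitrary: V X)
  case (Mu y \<phi>)
  have "(\<lambda>z. if z \<in> X - {y} then S - (V(y := U)) z else (V(y := U)) z)
      = (\<lambda>z. if z \<in> X then S - V z else V z)(y := U)" for U by (simp add: fun_eq_iff)
  then show ?case by (simp add: Mu del: fun_upd_apply)
next
  case (Nu y \<phi>)
  have "(\<lambda>z. if z \<in> X - {y} then S - (V(y := U)) z else (V(y := U)) z)
      = (\<lambda>z. if z \<in> X then S - V z else V z)(y := U)" for U by (simp add: fun_eq_iff)
  then show ?case by (simp add: Nu del: fun_upd_apply)
qed auto

text \<open>Complementation in S exchanges prefixpoints and postfixpoints. The second assumption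
  makes up for fixpoints being formed among all subsets of the state type instead of subsets of S.
  Arguing from the bounds alone covers raw formulas, whose bodies may fail to be monotone.\<close>

lemma gfp_complement:
  fixes f :: "'a set \<Rightarrow> 'a set"
  assumes "\<And>U. f U \<subseteq> S" "\<And>U. f (S \<inter> U) = f U"
  shows "gfp (\<lambda>U. S - f (S - U)) = S - lfp f"
proof (rule antisym)
  show "gfp (\<lambda>U. S - f (S - U)) \<subseteq> S - lfp f"
  proof (rule gfp_least)
    fix U assume U: "U \<subseteq> S - f (S - U)"
    then have "f (S - U) \<subseteq> S - U" using assms(1)[of "S - U"] by blast
    then have "lfp f \<subseteq> S - U" by (rule lfp_lowerbound)
    then show "U \<subseteq> S - lfp f" using U by blast
  qed
  have "S - (S - U) = S \<inter> U" for U by auto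
  moreover have "S - u \<subseteq> gfp (\<lambda>U. S - f (S - U))" if "f u \<subseteq> u" for u
    by (rule gfp_upperbound) (use that calculation in \<open>auto simp: assms(2)\<close>)
  ultimately have "S - gfp (\<lambda>U. S - f (S - U)) \<subseteq> u" if "f u \<subseteq> u" for u
    using that by blast
  then have "S - gfp (\<lambda>U. S - f (S - U)) \<subseteq> lfp f" by (rule lfp_greatest)
  then show "S - lfp f \<subseteq> gfp (\<lambda>U. S - f (S - U))" by blast
qed

lemma lfp_complement:
  fixes f :: "'a set \<Rightarrow> 'a set"
  assumes "\<And>U. f U \<subseteq> S" "\<And>U. f (S \<inter> U) = f U"
  shows "lfp (\<lambda>U. S - f (S - U)) = S - gfp f"
proof -
  let ?g = "\<lambda>U. S - f (S - U)"
  have "S - S \<inter> U = S - U" "S - (S - U) = S \<inter> U" for U by auto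
  then have "S - ?g (S - U) = f U" "?g (S \<inter> U) = ?g U" for U
    using assms(1)[of U] by (auto simp: assms(2))
  then have "gfp f = S - lfp ?g" using gfp_complement[of ?g S] by auto
  moreover have "lfp ?g \<subseteq> S" by (rule lfp_lowerbound) auto
  ultimately show ?thesis by auto
qed

lemma sem_neg:
  assumes R: "R \<subseteq> S \<times> S"
  shows "sem S R V (neg \<phi>) = S - sem S R V \<phi>"
proof (induction \<phi> arbitrary: V)
  case (Mu x \<phi>)
  have "(\<lambda>z. if z \<in> {x} then S - (V(x := U)) z else (V(x := U)) z) = V(x := S - U)" for U
    by (simp add: fun_eq_iff)
  then show ?case
    using gfp_complement[of "\<lambda>U. sem S R (V(x := U)) \<phi>" S, OF sem_subset]
    by (simp add: Mu flip_eq_flips sem_flips sem_upd_Int del: fun_upd_apply)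
next
  case (Nu x \<phi>)
  have "(\<lambda>z. if z \<in> {x} then S - (V(x := U)) z else (V(x := U)) z) = V(x := S - U)" for U
    by (simp add: fun_eq_iff)
  then show ?case
    using lfp_complement[of "\<lambda>U. sem S R (V(x := U)) \<phi>" S, OF sem_subset]
    by (simp add: Nu flip_eq_flips sem_flips sem_upd_Int del: fun_upd_apply)
qed (use R in auto)

lemma sem_imp: "R \<subseteq> S \<times> S \<Longrightarrow> sem S R V (imp \<phi> \<psi>) = (S - sem S R V \<phi>) \<union> sem S R V \<psi>"
  by (simp add: imp_def sem_neg)

lemma sem_iff: "R \<subseteq> S \<times> S \<Longrightarrow> sem S R V (iff \<phi> \<psi>)
    = ((S - sem S R V \<phi>) \<union> sem S R V \<psi>) \<inter> ((S - sem S R V \<psi>) \<union> sem S R V \<phi>)"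
  by (simp add: iff_def sem_imp)

lemma sem_fsubst:
  assumes R: "R \<subseteq> S \<times> S"
  shows "sem S R V (fsubst \<sigma> \<phi>) = sem S R (\<lambda>z. sem S R V (\<sigma> z)) \<phi>"
proof -
  have body: "sem S R (\<lambda>z. sem S R (V(y := U)) ((\<sigma>(x := Pos y)) z)) \<phi>
      = sem S R ((\<lambda>z. sem S R V (\<sigma> z))(x := U)) \<phi>" if y: "y = fresh \<sigma> \<phi> x" for V \<sigma> x \<phi> U y
  proof (rule sem_cong)
    fix z assume z: "z \<in> FV \<phi>"
    have "sem S R (V(y := U)) (\<sigma> z) = sem S R V (\<sigma> z)" if "z \<noteq> x"
      using fresh[of z \<phi> x \<sigma>] that z y by (intro sem_cong) auto
    then show "S \<inter> sem S R (V(y := U)) ((\<sigma>(x := Pos y)) z)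
        = S \<inter> ((\<lambda>z. sem S R V (\<sigma> z))(x := U)) z" by auto
  qed
  show ?thesis
  proof (induction \<phi> arbitrary: V \<sigma>)
    case (Mu x \<phi>)
    show ?case unfolding fsubst_Mu sem.simps Mu body[OF refl] ..
  next
    case (Nu x \<phi>)
    show ?case unfolding fsubst_Nu sem.simps Nu body[OF refl] ..
  qed (use sem_subset[of S R] in \<open>auto simp: sem_neg[OF R] dest: subsetD\<close>)
qed

lemma sem_subst1: "R \<subseteq> S \<times> S \<Longrightarrow> sem S R V (subst1 \<phi> \<psi> x) = sem S R (V(x := sem S R V \<psi>)) \<phi>"
  unfolding subst1_def by (simp add: sem_fsubst) (rule sem_cong, auto)

lemma Con_sem_mono: "Con X \<phi> \<Longrightarrow> (\<And>z. z \<in> X \<Longrightarrow> V z \<subseteq> V' z) \<Longrightarrow>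
      (\<And>z. z \<notin> X \<Longrightarrow> V z = V' z) \<Longrightarrow> sem S R V \<phi> \<subseteq> sem S R V' \<phi>"
  and Cocon_sem_mono: "Cocon X \<phi> \<Longrightarrow> (\<And>z. z \<in> X \<Longrightarrow> V z \<subseteq> V' z) \<Longrightarrow>
      (\<And>z. z \<notin> X \<Longrightarrow> V z = V' z) \<Longrightarrow> sem S R V \<phi> \<subseteq> sem S R V' \<phi>"
proof (induction arbitrary: V V' and V V'
    rule: mu_c_Con_Cocon.inducts(2,3)[where ?P1.0 = "\<lambda>_. True"])
  case (Con_free \<phi> X)
  have "sem S R V \<phi> = sem S R V' \<phi>"
    by (rule sem_cong) (use Con_free in \<open>metis disjoint_iff\<close>)
  then show ?case by simp
next
  case (Cocon_free \<phi> X)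
  have "sem S R V \<phi> = sem S R V' \<phi>"
    by (rule sem_cong) (use Cocon_free in \<open>metis disjoint_iff\<close>)
  then show ?case by simp
next
  case (Con_Or X \<phi> \<psi>)
  show ?case using Con_Or.IH[of V V'] Con_Or.prems by auto
next
  case (Con_And X \<phi> \<psi>)
  show ?case using Con_And.IH[of V V'] Con_And.prems by auto
next
  case (Con_Dia X \<phi>)
  have "sem S R V \<phi> \<subseteq> sem S R V' \<phi>" using Con_Dia.prems by (rule Con_Dia.IH)
  then show ?case by auto
next
  case (Con_Mu X y \<phi>)
  show ?case unfolding sem.simps
    by (rule lfp_mono, rule Con_Mu.IH) (use Con_Mu.prems in auto)
next
  case (Cocon_Or X \<phi> \<psi>)
  show ?case using Cocon_Or.IH[of V V'] Cocon_Or.prems by auto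
next
  case (Cocon_And X \<phi> \<psi>)
  show ?case using Cocon_And.IH[of V V'] Cocon_And.prems by auto
next
  case (Cocon_Box X \<phi>)
  have "sem S R V \<phi> \<subseteq> sem S R V' \<phi>" using Cocon_Box.prems by (rule Cocon_Box.IH)
  then show ?case by auto
next
  case (Cocon_Nu X y \<phi>)
  show ?case unfolding sem.simps
    by (rule gfp_mono, rule Cocon_Nu.IH) (use Cocon_Nu.prems in auto)
qed auto

lemma Con_mono: "Con {x} \<phi> \<Longrightarrow> mono (\<lambda>U. sem S R (V(x := U)) \<phi>)"
  and Cocon_mono: "Cocon {x} \<phi> \<Longrightarrow> mono (\<lambda>U. sem S R (V(x := U)) \<phi>)"
  by (rule monoI; erule Con_sem_mono Cocon_sem_mono; simp)+

lemma propositional_sem: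
  "propositional \<phi> \<Longrightarrow> s \<in> S \<Longrightarrow> s \<in> sem S R V \<phi> \<longleftrightarrow> prop_eval (\<lambda>p. s \<in> V p) \<phi>"
  by (induction \<phi>) auto

lemma soundness:
  assumes "\<phi> \<in> mu_c_logic L" "F \<in> Fr L"
  shows "valid_in F \<phi>"
proof -
  obtain S R where F: "F = (S, R)" by fastforce
  then have R: "R \<subseteq> S \<times> S" using assms(2) by (simp add: Fr_def is_frame_def)
  have "S \<subseteq> sem S R V \<phi>" for V
    using assms(1)
  proof (induction arbitrary: V)
    case (from_L \<phi>)
    then show ?case using assms(2) by (auto simp: F Fr_def valid_in_def)
  next
    case (taut \<phi>)
    then show ?case by (auto simp: tautology_def propositional_sem)
  next
    case (Mu_prefix x \<phi>)
    then show ?case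
      using lfp_fixpoint[OF Con_mono, of x \<phi> S R V] by (auto simp: sem_imp[OF R] sem_subst1[OF R])
  next
    case (Nu_postfix x \<phi>)
    then show ?case
      using gfp_fixpoint[OF Cocon_mono, of x \<phi> S R V] by (auto simp: sem_imp[OF R] sem_subst1[OF R])
  next
    case (Mu_dual x \<phi>)
    \<comment> \<open>The flips and negations on the right cancel literally, so the axiom has the
      form \<open>iff a a\<close>.\<close>
    show ?case by (auto simp: sem_iff[OF R] flip_eq_flips neg_flips flips_flips flips_disjoint)
  next
    case (mp \<phi> \<psi>)
    then show ?case by (fastforce simp: sem_imp[OF R])
  next
    case (Dia_mono \<phi> \<psi>)
    have "sem S R V \<phi> \<subseteq> sem S R V \<psi>" using Dia_mono.IH[of V] sem_subset by (fastforce simp: sem_imp[OF R])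
    then show ?case by (auto simp: sem_imp[OF R])
  next
    case (Box_mono \<phi> \<psi>)
    have "sem S R V \<phi> \<subseteq> sem S R V \<psi>" using Box_mono.IH[of V] sem_subset by (fastforce simp: sem_imp[OF R])
    then show ?case by (auto simp: sem_imp[OF R])
  next
    case (usubst \<phi> \<sigma>)
    show ?case unfolding sem_fsubst[OF R] by (rule usubst.IH)
  next
    case (Mu_least x \<phi> \<gamma>)
    have "sem S R V (subst1 \<phi> \<gamma> x) \<subseteq> sem S R V \<gamma>"
      using Mu_least.IH[of V] sem_subset by (fastforce simp: sem_imp[OF R])
    then have "sem S R V (Mu x \<phi>) \<subseteq> sem S R V \<gamma>" by (simp add: sem_subst1[OF R] lfp_lowerbound)
    then show ?case by (auto simp: sem_imp[OF R])
  next
    case (Nu_greatest x \<phi> \<gamma>)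
    have "sem S R V \<gamma> \<subseteq> sem S R V (subst1 \<phi> \<gamma> x)"
      using Nu_greatest.IH[of V] sem_subset by (fastforce simp: sem_imp[OF R])
    then have "sem S R V \<gamma> \<subseteq> sem S R V (Nu x \<phi>)" by (simp add: sem_subst1[OF R] gfp_upperbound)
    then show ?case by (auto simp: sem_imp[OF R])
  qed (use R in \<open>auto simp: falsum_def verum_def sem_imp[OF R] sem_iff[OF R] sem_neg[OF R]\<close>)
  then show ?thesis by (auto simp: F valid_in_def)
qed


section \<open>Maximal consistent sets\<close>

lemma basic_flips [simp]: "basic (flips X \<phi>) = basic \<phi>"
  by (induction \<phi> arbitrary: X) auto

lemma basic_neg [simp]: "basic (neg \<phi>) = basic \<phi>"
  by (induction \<phi>) auto

lemma basic_imp [simp]: "basic (imp \<phi> \<psi>) \<longleftrightarrow> basic \<phi> \<and> basic \<psi>"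
  by (simp add: imp_def)

lemma basic_mu_c: "basic \<phi> \<Longrightarrow> mu_c \<phi>"
  by (induction \<phi>) (auto intro: mu_c_Con_Cocon.intros)

lemma basic_falsum [simp]: "basic falsum"
  by (simp add: falsum_def)

text \<open>Derivability from hypotheses with detachment as the only rule: necessitation on
  hypotheses would invalidate \<open>deduction\<close>. It replaces the finite conjunctions of
  \<open>consistent\<close>, to which \<open>consistent_iff\<close> links it.\<close>

inductive_set Cn :: "form set \<Rightarrow> form set \<Rightarrow> form set" for L \<Gamma> where
  ax: "\<phi> \<in> L \<Longrightarrow> \<phi> \<in> Cn L \<Gamma>"
| hyp: "\<phi> \<in> \<Gamma> \<Longrightarrow> \<phi> \<in> Cn L \<Gamma>"
| detach: "imp \<phi> \<psi> \<in> Cn L \<Gamma> \<Longrightarrow> \<phi> \<in> Cn L \<Gamma> \<Longrightarrow> \<psi> \<in> Cn L \<Gamma>"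

lemma Cn_mono: "\<Gamma> \<subseteq> \<Delta> \<Longrightarrow> Cn L \<Gamma> \<subseteq> Cn L \<Delta>"
proof
  fix \<phi> assume "\<Gamma> \<subseteq> \<Delta>" "\<phi> \<in> Cn L \<Gamma>"
  from this(2,1) show "\<phi> \<in> Cn L \<Delta>" by induction (auto intro: Cn.intros)
qed

lemma Cn_compact: "\<phi> \<in> Cn L \<Gamma> \<Longrightarrow> \<exists>\<gamma>s. set \<gamma>s \<subseteq> \<Gamma> \<and> \<phi> \<in> Cn L (set \<gamma>s)"
proof (induction rule: Cn.induct)
  case (ax \<phi>)
  then show ?case by (intro exI[of _ "[]"]) (auto intro: Cn.intros)
next
  case (hyp \<phi>)
  then show ?case by (intro exI[of _ "[\<phi>]"]) (auto intro: Cn.intros)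
next
  case (detach \<phi> \<psi>)
  then obtain \<gamma>s \<delta>s where "set \<gamma>s \<subseteq> \<Gamma>" "set \<delta>s \<subseteq> \<Gamma>"
    "imp \<phi> \<psi> \<in> Cn L (set \<gamma>s)" "\<phi> \<in> Cn L (set \<delta>s)" by blast
  then show ?case
    using Cn_mono[of "set \<gamma>s" "set (\<gamma>s @ \<delta>s)" L] Cn_mono[of "set \<delta>s" "set (\<gamma>s @ \<delta>s)" L]
    by (intro exI[of _ "\<gamma>s @ \<delta>s"]) (auto intro: Cn.detach)
qed

locale normal_logic =
  fixes L :: "form set"
  assumes normal: "normal_modal_logic L"
begin

lemma L_basic: "\<phi> \<in> L \<Longrightarrow> basic \<phi>"
  and L_taut: "tautology \<phi> \<Longrightarrow> \<phi> \<in> L"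
  and L_mp: "\<phi> \<in> L \<Longrightarrow> imp \<phi> \<psi> \<in> L \<Longrightarrow> \<psi> \<in> L"
  and L_nec: "\<phi> \<in> L \<Longrightarrow> Box \<phi> \<in> L"
  and L_subst: "\<phi> \<in> L \<Longrightarrow> (\<And>p. basic (\<sigma> p)) \<Longrightarrow> fsubst \<sigma> \<phi> \<in> L"
  using normal unfolding normal_modal_logic_def by blast+

lemma L_taut_inst:
  assumes "tautology \<tau>" "basic a" "basic b" "basic c"
  shows "fsubst (\<lambda>n. if n = 0 then a else if n = 1 then b else c) \<tau> \<in> L"
  using assms L_taut by (intro L_subst) auto

lemma L_K:
  assumes "basic a" "basic b"
  shows "imp (Box (imp a b)) (imp (Box a) (Box b)) \<in> L"
proof -
  have "imp (Box (imp (Pos 0) (Pos 1))) (imp (Box (Pos 0)) (Box (Pos 1))) \<in> L"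
    using normal unfolding normal_modal_logic_def by blast
  from L_subst[OF this, of "\<lambda>n. if n = 0 then a else b"] show ?thesis using assms by simp
qed

lemma taut_I: "basic a \<Longrightarrow> imp a a \<in> L"
  using L_taut_inst[of "imp (Pos 0) (Pos 0)" a a a] by (simp add: tautology_def imp_def neg_fsubst)

lemma
  assumes "basic a" "basic b"
  shows taut_K: "imp a (imp b a) \<in> L"
    and taut_conjI: "imp a (imp b (And a b)) \<in> L"
    and taut_conj1: "imp (And a b) a \<in> L"
    and taut_conj2: "imp (And a b) b \<in> L"
    and taut_contr: "imp (neg a) (imp a b) \<in> L"
  using
    L_taut_inst[of "imp (Pos 0) (imp (Pos 1) (Pos 0))" a b b]
    L_taut_inst[of "imp (Pos 0) (imp (Pos 1) (And (Pos 0) (Pos 1)))" a b b]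
    L_taut_inst[of "imp (And (Pos 0) (Pos 1)) (Pos 0)" a b b]
    L_taut_inst[of "imp (And (Pos 0) (Pos 1)) (Pos 1)" a b b]
    L_taut_inst[of "imp (neg (Pos 0)) (imp (Pos 0) (Pos 1))" a b b]
    assms
  by (auto simp: tautology_def imp_def neg_fsubst)

lemma taut_S:
  assumes "basic a" "basic b" "basic c"
  shows "imp (imp a (imp b c)) (imp (imp a b) (imp a c)) \<in> L"
  using L_taut_inst[of "imp (imp (Pos 0) (imp (Pos 1) (Pos 2))) (imp (imp (Pos 0) (Pos 1)) (imp (Pos 0) (Pos 2)))" a b c]
    assms
  by (auto simp: tautology_def imp_def neg_fsubst)

lemma taut_uncurry:
  assumes "basic a" "basic b" "basic c"
  shows "imp (imp b (imp a c)) (imp (And a b) c) \<in> L"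
  using L_taut_inst[of "imp (imp (Pos 1) (imp (Pos 0) (Pos 2))) (imp (And (Pos 0) (Pos 1)) (Pos 2))" a b c]
    assms
  by (auto simp: tautology_def imp_def neg_fsubst)

lemma taut_falsum: "basic a \<Longrightarrow> imp (imp a falsum) (neg a) \<in> L"
  and taut_neg_falsum: "basic a \<Longrightarrow> imp (neg a) (imp a falsum) \<in> L"
  and taut_verum: "verum \<in> L"
proof -
  have v: "verum \<in> L" by (rule L_taut) (simp add: tautology_def verum_def falsum_def)
  show "verum \<in> L" by (rule v)
  assume a: "basic a"
  show "imp (neg a) (imp a falsum) \<in> L" using taut_contr[OF a basic_falsum] .
  \<comment> \<open>Letter 1 is sent to \<open>Pos 0\<close>, so that
    \<open>And (Pos 1) (Neg 1)\<close> becomes \<open>falsum\<close> itself.\<close>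
  have "imp verum (imp (imp a falsum) (neg a)) \<in> L"
    using L_taut_inst[of "imp (neg (And (Pos 1) (Neg 1)))
      (imp (imp (Pos 0) (And (Pos 1) (Neg 1))) (neg (Pos 0)))" a "Pos 0" "Pos 0"] a
    by (auto simp: tautology_def imp_def neg_fsubst falsum_def verum_def)
  then show "imp (imp a falsum) (neg a) \<in> L" by (rule L_mp[OF v])
qed

lemma Cn_basic: "\<phi> \<in> Cn L \<Gamma> \<Longrightarrow> \<Gamma> \<subseteq> Collect basic \<Longrightarrow> basic \<phi>"
  by (induction rule: Cn.induct) (auto dest: L_basic)

lemma deduction:
  assumes "\<psi> \<in> Cn L (insert \<phi> \<Gamma>)" "basic \<phi>" "\<Gamma> \<subseteq> Collect basic"
  shows "imp \<phi> \<psi> \<in> Cn L \<Gamma>"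
  using assms(1)
proof induction
  case (ax \<psi>)
  then show ?case using taut_K[of \<psi> \<phi>] assms(2) L_basic by (blast intro: Cn.intros)
next
  case (hyp \<psi>)
  show ?case
  proof (cases "\<psi> = \<phi>")
    case True
    then show ?thesis using taut_I[OF assms(2)] by (simp add: Cn.ax)
  next
    case False
    then show ?thesis using taut_K[of \<psi> \<phi>] hyp assms(2,3) by (auto intro: Cn.intros)
  qed
next
  case (detach \<psi> \<chi>)
  have "basic \<psi>" "basic \<chi>" using Cn_basic[OF detach.hyps(1)] assms by auto
  then show ?case using taut_S[of \<phi> \<psi> \<chi>] assms(2) detach.IH by (blast intro: Cn.intros)
qed

text \<open>Iterated use of \<open>deduction\<close>, with the antecedents gathered into the
  conjunction that \<open>consistent\<close> is phrased with.\<close>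

lemma Cn_foldr:
  assumes "\<psi> \<in> Cn L (set \<gamma>s \<union> \<Delta>)" "set \<gamma>s \<union> \<Delta> \<subseteq> Collect basic"
  shows "imp (foldr And \<gamma>s verum) \<psi> \<in> Cn L \<Delta>"
  using assms
proof (induction \<gamma>s arbitrary: \<psi>)
  case Nil
  have "basic \<psi>" using Cn_basic Nil by blast
  then show ?case using taut_K[of \<psi> verum] L_basic[OF taut_verum] Nil by (auto intro: Cn.intros)
next
  case (Cons \<gamma> \<gamma>s)
  have b: "basic \<psi>" using Cn_basic[OF Cons.prems] .
  have "basic \<gamma>" "set \<gamma>s \<union> \<Delta> \<subseteq> Collect basic" using Cons.prems(2) by auto
  moreover have "basic (foldr And \<gamma>s verum)"
    using \<open>set \<gamma>s \<union> \<Delta> \<subseteq> _\<close> L_basic[OF taut_verum] by (induction \<gamma>s) auto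
  moreover have "imp (foldr And \<gamma>s verum) (imp \<gamma> \<psi>) \<in> Cn L \<Delta>"
    using Cons.prems(1) calculation by (intro Cons.IH deduction) auto
  ultimately show ?case
    using taut_uncurry[of \<gamma> "foldr And \<gamma>s verum" \<psi>] b by (auto intro: Cn.intros)
qed

lemma Cn_empty: "Cn L {} = L"
proof
  show "Cn L {} \<subseteq> L"
  proof
    fix \<phi> assume "\<phi> \<in> Cn L {}"
    then show "\<phi> \<in> L" by induction (auto intro: L_mp)
  qed
qed (auto intro: Cn.intros)

lemma consistent_iff:
  assumes "\<Gamma> \<subseteq> Collect basic"
  shows "consistent L \<Gamma> \<longleftrightarrow> falsum \<notin> Cn L \<Gamma>"
proof
  assume c: "consistent L \<Gamma>"
  show "falsum \<notin> Cn L \<Gamma>"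
  proof
    assume "falsum \<in> Cn L \<Gamma>"
    then obtain \<gamma>s where \<gamma>s: "set \<gamma>s \<subseteq> \<Gamma>" "falsum \<in> Cn L (set \<gamma>s)" by (blast dest: Cn_compact)
    then have *: "imp (foldr And \<gamma>s verum) falsum \<in> L"
      using Cn_foldr[of falsum \<gamma>s "{}"] assms by (auto simp: Cn_empty)
    then have "neg (foldr And \<gamma>s verum) \<in> L"
      using L_mp[OF * taut_falsum] L_basic[OF *] by simp
    then show False using c \<gamma>s(1) by (auto simp: consistent_def)
  qed
next
  assume f: "falsum \<notin> Cn L \<Gamma>"
  show "consistent L \<Gamma>" unfolding consistent_def
  proof (intro allI impI notI)
    fix \<gamma>s assume \<gamma>s: "set \<gamma>s \<subseteq> \<Gamma>" and neg: "neg (foldr And \<gamma>s verum) \<in> L"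
    have "foldr And \<gamma>s verum \<in> Cn L \<Gamma>"
      using \<gamma>s
    proof (induction \<gamma>s)
      case Nil
      then show ?case using taut_verum by (auto intro: Cn.intros)
    next
      case (Cons \<gamma> \<gamma>s)
      then have "foldr And \<gamma>s verum \<in> Cn L \<Gamma>" "\<gamma> \<in> Cn L \<Gamma>" by (auto intro: Cn.hyp)
      moreover from this have "basic (foldr And \<gamma>s verum)" "basic \<gamma>" using Cn_basic[OF _ assms] by auto
      ultimately show ?case using Cn.detach[OF Cn.detach[OF Cn.ax[OF taut_conjI]]] by simp
    qed
    moreover have "imp (foldr And \<gamma>s verum) falsum \<in> L"
      using L_mp[OF neg taut_neg_falsum] L_basic[OF neg] by simp
    ultimately show False using f by (auto intro: Cn.intros)
  qed
qed

lemma lindenbaum: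
  assumes "\<Gamma> \<subseteq> Collect basic" "falsum \<notin> Cn L \<Gamma>"
  obtains \<Delta> where "\<Gamma> \<subseteq> \<Delta>" "max_consistent L \<Delta>"
proof -
  define A where "A = {\<Delta>. \<Gamma> \<subseteq> \<Delta> \<and> \<Delta> \<subseteq> Collect basic \<and> falsum \<notin> Cn L \<Delta>}"
  have "\<exists>M\<in>A. \<forall>X\<in>A. M \<subseteq> X \<longrightarrow> X = M"
  proof (rule subset_Zorn_nonempty)
    show "A \<noteq> {}" using assms by (auto simp: A_def)
    fix C assume C: "C \<noteq> {}" "subset.chain A C"
    then have CA: "\<And>\<Delta>. \<Delta> \<in> C \<Longrightarrow> \<Delta> \<in> A" by (auto simp: subset.chain_def)
    \<comment> \<open>Compactness: a derivation of \<open>falsum\<close> uses finitely many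
      hypotheses, and these already lie in one member of the chain.\<close>
    have "falsum \<notin> Cn L (\<Union>C)"
    proof
      assume "falsum \<in> Cn L (\<Union>C)"
      then obtain \<gamma>s where \<gamma>s: "set \<gamma>s \<subseteq> \<Union>C" "falsum \<in> Cn L (set \<gamma>s)" by (blast dest: Cn_compact)
      then obtain \<Delta> where "\<Delta> \<in> C" "set \<gamma>s \<subseteq> \<Delta>"
        using finite_subset_Union_chain[OF _ \<gamma>s(1) C] by auto
      then show False using \<gamma>s(2) Cn_mono[of "set \<gamma>s" \<Delta> L] CA by (auto simp: A_def)
    qed
    then show "\<Union>C \<in> A" using C(1) CA by (fastforce simp: A_def)
  qed
  then obtain \<Delta> where \<Delta>: "\<Delta> \<in> A" "\<And>X. X \<in> A \<Longrightarrow> \<Delta> \<subseteq> X \<Longrightarrow> X = \<Delta>" by blast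
  have "max_consistent L \<Delta>"
    unfolding max_consistent_def
  proof (intro conjI allI impI)
    show "\<Delta> \<subseteq> Collect basic" using \<Delta>(1) by (auto simp: A_def)
    then show "consistent L \<Delta>" using \<Delta>(1) by (auto simp: A_def consistent_iff)
    fix X assume X: "\<Delta> \<subset> X" "X \<subseteq> Collect basic"
    then show "\<not> consistent L X"
      using \<Delta>(2)[of X] \<Delta>(1) by (auto simp: A_def consistent_iff)
  qed
  then show ?thesis using that \<Delta>(1) by (auto simp: A_def)
qed

section \<open>Membership in maximal consistent sets, connective by connective\<close>

lemma mcs_basic: "max_consistent L \<Gamma> \<Longrightarrow> \<phi> \<in> \<Gamma> \<Longrightarrow> basic \<phi>"
  by (auto simp: max_consistent_def)

lemma mcs_Cn_neg:
  assumes "max_consistent L \<Gamma>" "basic \<phi>" "\<phi> \<notin> \<Gamma>"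
  shows "neg \<phi> \<in> Cn L \<Gamma>"
proof -
  have \<Gamma>: "\<Gamma> \<subseteq> Collect basic" using assms(1) by (simp add: max_consistent_def)
  have "\<not> consistent L (insert \<phi> \<Gamma>)"
    using assms \<Gamma> unfolding max_consistent_def by blast
  then have "falsum \<in> Cn L (insert \<phi> \<Gamma>)" using consistent_iff[of "insert \<phi> \<Gamma>"] assms(2) \<Gamma> by simp
  then have "imp \<phi> falsum \<in> Cn L \<Gamma>" using assms(2) \<Gamma> by (rule deduction)
  then show ?thesis using taut_falsum[OF assms(2)] by (auto intro: Cn.intros)
qed

lemma mcs_falsum: "max_consistent L \<Gamma> \<Longrightarrow> falsum \<notin> Cn L \<Gamma>"
  using consistent_iff by (auto simp: max_consistent_def)

lemma mcs_not_both:
  assumes "max_consistent L \<Gamma>" "\<phi> \<in> Cn L \<Gamma>"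
  shows "neg \<phi> \<notin> Cn L \<Gamma>"
proof
  assume "neg \<phi> \<in> Cn L \<Gamma>"
  moreover have "basic \<phi>" using Cn_basic[OF assms(2)] assms(1) by (simp add: max_consistent_def)
  ultimately have "falsum \<in> Cn L \<Gamma>" using taut_neg_falsum[of \<phi>] assms(2) by (blast intro: Cn.intros)
  then show False using mcs_falsum[OF assms(1)] by simp
qed

lemma mcs_Cn: "max_consistent L \<Gamma> \<Longrightarrow> Cn L \<Gamma> = \<Gamma>"
  by (rule antisym, metis subsetI Cn_basic max_consistent_def mcs_Cn_neg mcs_not_both)
    (auto intro: Cn.intros)

lemma mcs_L: "max_consistent L \<Gamma> \<Longrightarrow> \<phi> \<in> L \<Longrightarrow> \<phi> \<in> \<Gamma>"
  using Cn.ax[of \<phi> L \<Gamma>] by (simp add: mcs_Cn)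

lemma mcs_mp: "max_consistent L \<Gamma> \<Longrightarrow> imp \<phi> \<psi> \<in> \<Gamma> \<Longrightarrow> \<phi> \<in> \<Gamma> \<Longrightarrow> \<psi> \<in> \<Gamma>"
  using Cn.detach[of \<phi> \<psi> L \<Gamma>] by (simp add: mcs_Cn)

lemma mcs_neg: "max_consistent L \<Gamma> \<Longrightarrow> basic \<phi> \<Longrightarrow> neg \<phi> \<in> \<Gamma> \<longleftrightarrow> \<phi> \<notin> \<Gamma>"
  using mcs_Cn_neg[of \<Gamma> \<phi>] mcs_not_both[of \<Gamma> \<phi>] mcs_Cn[of \<Gamma>] by auto

lemma mcs_And:
  assumes "max_consistent L \<Gamma>" "basic \<phi>" "basic \<psi>"
  shows "And \<phi> \<psi> \<in> \<Gamma> \<longleftrightarrow> \<phi> \<in> \<Gamma> \<and> \<psi> \<in> \<Gamma>"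
  using mcs_mp[OF assms(1)] mcs_L[OF assms(1)] taut_conjI[OF assms(2,3)]
    taut_conj1[OF assms(2,3)] taut_conj2[OF assms(2,3)] by blast

lemma mcs_Or:
  assumes "max_consistent L \<Gamma>" "basic \<phi>" "basic \<psi>"
  shows "Or \<phi> \<psi> \<in> \<Gamma> \<longleftrightarrow> \<phi> \<in> \<Gamma> \<or> \<psi> \<in> \<Gamma>"
  using mcs_And[OF assms(1), of "neg \<phi>" "neg \<psi>"] mcs_neg[OF assms(1), of "Or \<phi> \<psi>"]
    mcs_neg[OF assms(1), of \<phi>] mcs_neg[OF assms(1), of \<psi>] assms by auto

lemma mcs_imp:
  assumes "max_consistent L \<Gamma>" "basic \<phi>" "basic \<psi>"
  shows "imp \<phi> \<psi> \<in> \<Gamma> \<longleftrightarrow> (\<phi> \<in> \<Gamma> \<longrightarrow> \<psi> \<in> \<Gamma>)"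
  using assms by (auto simp: imp_def mcs_Or mcs_neg)

lemma mcs_Box:
  assumes "max_consistent L \<Gamma>" "basic \<phi>"
  shows "Box \<phi> \<in> \<Gamma> \<longleftrightarrow> (\<forall>\<Delta>. (\<Gamma>, \<Delta>) \<in> snd (canonical_frame L) \<longrightarrow> \<phi> \<in> \<Delta>)"
proof
  assume r: "\<forall>\<Delta>. (\<Gamma>, \<Delta>) \<in> snd (canonical_frame L) \<longrightarrow> \<phi> \<in> \<Delta>"
  let ?U = "{\<psi>. Box \<psi> \<in> \<Gamma>}"
  have U: "?U \<subseteq> Collect basic" using mcs_basic[OF assms(1)] by fastforce
  \<comment> \<open>Necessitation and the K axiom close the formulas boxed in \<Gamma> under
    L-consequence. It then suffices to derive \<phi> from them; otherwise a Lindenbaum extension is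
    a successor that omits \<phi>.\<close>
  have Box: "Box \<psi> \<in> \<Gamma>" if "\<psi> \<in> Cn L ?U" for \<psi>
    using that
  proof induction
    case (ax \<psi>)
    then show ?case using L_nec mcs_L assms(1) by blast
  next
    case (detach \<psi> \<chi>)
    then have "basic \<psi>" "basic \<chi>" using mcs_basic[OF assms(1)] by fastforce+
    then show ?case using L_K[of \<psi> \<chi>] detach.IH mcs_mp[OF assms(1)] mcs_L[OF assms(1)] by blast
  qed auto
  have "falsum \<in> Cn L (insert (neg \<phi>) ?U)"
  proof (rule ccontr)
    assume "falsum \<notin> Cn L (insert (neg \<phi>) ?U)"
    then obtain \<Delta> where "insert (neg \<phi>) ?U \<subseteq> \<Delta>" "max_consistent L \<Delta>"
      using lindenbaum[of "insert (neg \<phi>) ?U"] U assms(2) by auto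
    then show False
      using r assms mcs_neg[of \<Delta> \<phi>] by (auto simp: canonical_frame_def)
  qed
  then have "imp (neg \<phi>) falsum \<in> Cn L ?U" using deduction U assms(2) by simp
  then have "\<phi> \<in> Cn L ?U" using taut_falsum[of "neg \<phi>"] assms(2) by (auto intro: Cn.intros)
  then show "Box \<phi> \<in> \<Gamma>" by (rule Box)
qed (auto simp: canonical_frame_def)

lemma mcs_Dia:
  assumes "max_consistent L \<Gamma>" "basic \<phi>"
  shows "Dia \<phi> \<in> \<Gamma> \<longleftrightarrow> (\<exists>\<Delta>. (\<Gamma>, \<Delta>) \<in> snd (canonical_frame L) \<and> \<phi> \<in> \<Delta>)"
  using mcs_Box[OF assms(1), of "neg \<phi>"] mcs_neg[OF assms(1), of "Dia \<phi>"] assms(2)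
    mcs_neg[of _ \<phi>] by (auto simp: canonical_frame_def)

end


section \<open>The truth lemma for quotients\<close>

text \<open>The fixpoint axiom and rule read through an environment: the bound variable picked by
  the substitution is eliminated by \<open>unfold_binder\<close>.\<close>

lemma
  assumes "Con {x} \<phi>" "\<And>z. canon (\<delta> z)"
  shows mu_c_logic_prefix:
      "imp (fsubst (\<delta>(x := fsubst \<delta> (Mu x \<phi>))) \<phi>) (fsubst \<delta> (Mu x \<phi>)) \<in> mu_c_logic L"
    and mu_c_logic_least: "imp (fsubst (\<delta>(x := \<gamma>)) \<phi>) \<gamma> \<in> mu_c_logic L \<Longrightarrow>
      imp (fsubst \<delta> (Mu x \<phi>)) \<gamma> \<in> mu_c_logic L"
proof -
  let ?w = "fresh \<delta> \<phi> x"
  let ?\<phi> = "fsubst (\<delta>(x := Pos ?w)) \<phi>"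
  have u: "subst1 ?\<phi> \<gamma> ?w = fsubst (\<delta>(x := \<gamma>)) \<phi>" for \<gamma>
    using assms(2) by (intro unfold_binder) (auto simp: canon_def)
  have "Con {?w} ?\<phi>"
    by (rule Con_fsubst[OF assms(1)])
      (use assms(2) fresh[of _ \<phi> x \<delta>] in \<open>auto simp: canon_def intro: mu_c_Con_Cocon.intros\<close>)
  from mu_c_logic.Mu_prefix[OF this] mu_c_logic.Mu_least[OF this]
  show "imp (fsubst (\<delta>(x := fsubst \<delta> (Mu x \<phi>))) \<phi>) (fsubst \<delta> (Mu x \<phi>)) \<in> mu_c_logic L"
    and "imp (fsubst (\<delta>(x := \<gamma>)) \<phi>) \<gamma> \<in> mu_c_logic L \<Longrightarrow>
      imp (fsubst \<delta> (Mu x \<phi>)) \<gamma> \<in> mu_c_logic L"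
    unfolding u fsubst_Mu by auto
qed

lemma
  assumes "Cocon {x} \<phi>" "\<And>z. canon (\<delta> z)"
  shows mu_c_logic_postfix:
      "imp (fsubst \<delta> (Nu x \<phi>)) (fsubst (\<delta>(x := fsubst \<delta> (Nu x \<phi>))) \<phi>) \<in> mu_c_logic L"
    and mu_c_logic_greatest: "imp \<gamma> (fsubst (\<delta>(x := \<gamma>)) \<phi>) \<in> mu_c_logic L \<Longrightarrow>
      imp \<gamma> (fsubst \<delta> (Nu x \<phi>)) \<in> mu_c_logic L"
proof -
  let ?w = "fresh \<delta> \<phi> x"
  let ?\<phi> = "fsubst (\<delta>(x := Pos ?w)) \<phi>"
  have u: "subst1 ?\<phi> \<gamma> ?w = fsubst (\<delta>(x := \<gamma>)) \<phi>" for \<gamma>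
    using assms(2) by (intro unfold_binder) (auto simp: canon_def)
  have "Cocon {?w} ?\<phi>"
    by (rule Cocon_fsubst[OF assms(1)])
      (use assms(2) fresh[of _ \<phi> x \<delta>] in \<open>auto simp: canon_def intro: mu_c_Con_Cocon.intros\<close>)
  from mu_c_logic.Nu_postfix[OF this] mu_c_logic.Nu_greatest[OF this]
  show "imp (fsubst \<delta> (Nu x \<phi>)) (fsubst (\<delta>(x := fsubst \<delta> (Nu x \<phi>))) \<phi>) \<in> mu_c_logic L"
    and "imp \<gamma> (fsubst (\<delta>(x := \<gamma>)) \<phi>) \<in> mu_c_logic L \<Longrightarrow>
      imp \<gamma> (fsubst \<delta> (Nu x \<phi>)) \<in> mu_c_logic L"
    unfolding u fsubst_Nu by auto
qed

text \<open>The formulas met when \<open>\<phi>\<close>, with its free variables read through \<open>\<delta>\<close>, is unravelled by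
  replacing bound variables by the fixpoint formulas binding them: a finite substitute for the
  Fischer-Ladner closure that follows the recursive structure of \<open>\<phi>\<close>.\<close>

primrec cl :: "form \<Rightarrow> (var \<Rightarrow> form) \<Rightarrow> form set" where
  "cl (Pos p) \<delta> = {\<delta> p}"
| "cl (Neg p) \<delta> = {\<delta> p}"
| "cl (Or \<phi> \<psi>) \<delta> = cl \<phi> \<delta> \<union> cl \<psi> \<delta>"
| "cl (And \<phi> \<psi>) \<delta> = cl \<phi> \<delta> \<union> cl \<psi> \<delta>"
| "cl (Dia \<phi>) \<delta> = insert (fsubst \<delta> (Dia \<phi>)) (cl \<phi> \<delta>)"
| "cl (Box \<phi>) \<delta> = insert (fsubst \<delta> (Box \<phi>)) (cl \<phi> \<delta>)"
| "cl (Mu x \<phi>) \<delta> = insert (fsubst \<delta> (Mu x \<phi>)) (cl \<phi> (\<delta>(x := fsubst \<delta> (Mu x \<phi>))))"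
| "cl (Nu x \<phi>) \<delta> = insert (fsubst \<delta> (Nu x \<phi>)) (cl \<phi> (\<delta>(x := fsubst \<delta> (Nu x \<phi>))))"

lemma finite_cl: "finite (cl \<phi> \<delta>)"
  by (induction \<phi> arbitrary: \<delta>) auto

text \<open>Isolates what the truth lemma needs of a filtration. Edges are preserved without
  restriction (\<open>R'_min\<close>), but boxes and diamonds are reflected only for formulas in
  \<Sigma>. As \<Sigma> need not be closed under negation, \<open>R'_Dia\<close> is stated beside
  \<open>R'_Box\<close>. \<open>definable\<close> supplies the formulas to which the induction rules
  are applied.\<close>

locale canonical_quotient =
  fixes L :: "form set" and W :: "'w set" and R :: "('w \<times> 'w) set"
    and mem :: "'w \<Rightarrow> form \<Rightarrow> bool" and c :: "'w \<Rightarrow> 'b" and R' :: "('b \<times> 'b) set"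
    and \<Sigma> :: "form set"
  assumes mem_neg: "\<Gamma> \<in> W \<Longrightarrow> canon a \<Longrightarrow> mem \<Gamma> (neg a) \<longleftrightarrow> \<not> mem \<Gamma> a"
    and mem_Or: "\<Gamma> \<in> W \<Longrightarrow> canon a \<Longrightarrow> canon b \<Longrightarrow> mem \<Gamma> (Or a b) \<longleftrightarrow> mem \<Gamma> a \<or> mem \<Gamma> b"
    and mem_And: "\<Gamma> \<in> W \<Longrightarrow> canon a \<Longrightarrow> canon b \<Longrightarrow> mem \<Gamma> (And a b) \<longleftrightarrow> mem \<Gamma> a \<and> mem \<Gamma> b"
    and mem_Dia: "\<Gamma> \<in> W \<Longrightarrow> canon a \<Longrightarrow> mem \<Gamma> (Dia a) \<longleftrightarrow> (\<exists>\<Delta>\<in>W. (\<Gamma>, \<Delta>) \<in> R \<and> mem \<Delta> a)"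
    and mem_Box: "\<Gamma> \<in> W \<Longrightarrow> canon a \<Longrightarrow> mem \<Gamma> (Box a) \<longleftrightarrow> (\<forall>\<Delta>\<in>W. (\<Gamma>, \<Delta>) \<in> R \<longrightarrow> mem \<Delta> a)"
    and provable_iff: "canon a \<Longrightarrow> canon b \<Longrightarrow>
      imp a b \<in> mu_c_logic L \<longleftrightarrow> (\<forall>\<Gamma>\<in>W. mem \<Gamma> a \<longrightarrow> mem \<Gamma> b)"
    and R'_subset: "R' \<subseteq> c ` W \<times> c ` W"
    and R'_min: "\<Gamma> \<in> W \<Longrightarrow> \<Delta> \<in> W \<Longrightarrow> (\<Gamma>, \<Delta>) \<in> R \<Longrightarrow> (c \<Gamma>, c \<Delta>) \<in> R'"
    and R'_Box: "\<Gamma> \<in> W \<Longrightarrow> \<Delta> \<in> W \<Longrightarrow> (c \<Gamma>, c \<Delta>) \<in> R' \<Longrightarrow> canon a \<Longrightarrow> Box a \<in> \<Sigma> \<Longrightarrow>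
      mem \<Gamma> (Box a) \<Longrightarrow> mem \<Delta> a"
    and R'_Dia: "\<Gamma> \<in> W \<Longrightarrow> \<Delta> \<in> W \<Longrightarrow> (c \<Gamma>, c \<Delta>) \<in> R' \<Longrightarrow> canon a \<Longrightarrow> Dia a \<in> \<Sigma> \<Longrightarrow>
      mem \<Delta> a \<Longrightarrow> mem \<Gamma> (Dia a)"
    and saturated: "a \<in> \<Sigma> \<Longrightarrow> canon a \<Longrightarrow> \<Gamma> \<in> W \<Longrightarrow> \<Delta> \<in> W \<Longrightarrow> c \<Gamma> = c \<Delta> \<Longrightarrow> mem \<Gamma> a \<Longrightarrow> mem \<Delta> a"
    and definable: "U \<subseteq> c ` W \<Longrightarrow> \<exists>\<gamma>. canon \<gamma> \<and> (\<forall>\<Gamma>\<in>W. mem \<Gamma> \<gamma> \<longleftrightarrow> c \<Gamma> \<in> U)"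
begin

text \<open>One member of a class suffices. For a formula outside \<Sigma> the members may disagree,
  so passing from membership to \<open>ext\<close> is always possible but the way back is
  not.\<close>

definition ext :: "form \<Rightarrow> 'b set" where
  "ext a = c ` {\<Gamma> \<in> W. mem \<Gamma> a}"

abbreviation Sem :: "(var \<Rightarrow> form) \<Rightarrow> form \<Rightarrow> 'b set" where
  "Sem \<delta> \<equiv> sem (c ` W) R' (ext \<circ> \<delta>)"

definition truth :: "form \<Rightarrow> bool" where
  "truth \<phi> \<longleftrightarrow> (\<forall>\<delta>. (\<forall>z. canon (\<delta> z)) \<longrightarrow> cl \<phi> \<delta> \<subseteq> \<Sigma> \<longrightarrow>
    (\<forall>\<Gamma>\<in>W. mem \<Gamma> (fsubst \<delta> \<phi>) \<longleftrightarrow> c \<Gamma> \<in> Sem \<delta> \<phi>))"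

text \<open>Here the variables in \<open>X\<close> may take values outside \<open>\<Sigma>\<close>. In the applications these are
  formulas defining fixpoints of the quotient, to which the induction rules for \<open>Mu\<close> and \<open>Nu\<close> are
  then applied. Only one half of the truth lemma survives, and it does so because continuous
  formulas reach \<open>X\<close> through diamonds only (respectively boxes).\<close>

definition truth_up :: "var set \<Rightarrow> form \<Rightarrow> bool" where
  "truth_up X \<phi> \<longleftrightarrow> (\<forall>\<delta> \<delta>'. (\<forall>z. canon (\<delta> z)) \<longrightarrow> (\<forall>z. canon (\<delta>' z)) \<longrightarrow> cl \<phi> \<delta> \<subseteq> \<Sigma> \<longrightarrow>
    (\<forall>z. z \<notin> X \<longrightarrow> \<delta>' z = \<delta> z) \<longrightarrow> (\<forall>\<Gamma>\<in>W. mem \<Gamma> (fsubst \<delta>' \<phi>) \<longrightarrow> c \<Gamma> \<in> Sem \<delta>' \<phi>))"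

text \<open>Going from truth back to membership requires that a value be constant on classes. Values
  left as in \<open>\<delta>\<close> have this by \<open>saturated\<close>; displaced ones must be
  assumed to have it, an asymmetry with \<open>truth_up\<close> caused by
  \<open>ext\<close>.\<close>

definition truth_down :: "var set \<Rightarrow> form \<Rightarrow> bool" where
  "truth_down X \<phi> \<longleftrightarrow> (\<forall>\<delta> \<delta>'. (\<forall>z. canon (\<delta> z)) \<longrightarrow> (\<forall>z. canon (\<delta>' z)) \<longrightarrow> cl \<phi> \<delta> \<subseteq> \<Sigma> \<longrightarrow>
    (\<forall>z. z \<notin> X \<longrightarrow> \<delta>' z = \<delta> z) \<longrightarrow>
    (\<forall>z\<in>X. \<delta>' z \<noteq> \<delta> z \<longrightarrow> (\<forall>\<Gamma>\<in>W. c \<Gamma> \<in> ext (\<delta>' z) \<longrightarrow> mem \<Gamma> (\<delta>' z))) \<longrightarrow>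
    (\<forall>\<Gamma>\<in>W. c \<Gamma> \<in> Sem \<delta>' \<phi> \<longrightarrow> mem \<Gamma> (fsubst \<delta>' \<phi>)))"

lemma ext_intro: "\<Gamma> \<in> W \<Longrightarrow> mem \<Gamma> a \<Longrightarrow> c \<Gamma> \<in> ext a"
  by (auto simp: ext_def)

lemma mem_ext:
  assumes "a \<in> \<Sigma>" "canon a" "\<Gamma> \<in> W"
  shows "c \<Gamma> \<in> ext a \<longleftrightarrow> mem \<Gamma> a"
proof
  assume "c \<Gamma> \<in> ext a"
  then obtain \<Delta> where "\<Delta> \<in> W" "mem \<Delta> a" "c \<Delta> = c \<Gamma>" by (auto simp: ext_def)
  then show "mem \<Gamma> a" using saturated assms by blast
qed (rule ext_intro[OF assms(3)])

lemma definable_ext: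
  assumes "U \<subseteq> c ` W"
  obtains \<gamma> where "canon \<gamma>" "ext \<gamma> = U" "\<And>\<Gamma>. \<Gamma> \<in> W \<Longrightarrow> mem \<Gamma> \<gamma> \<longleftrightarrow> c \<Gamma> \<in> U"
proof -
  obtain \<gamma> where "canon \<gamma>" "\<forall>\<Gamma>\<in>W. mem \<Gamma> \<gamma> \<longleftrightarrow> c \<Gamma> \<in> U" using definable[OF assms] by blast
  moreover from this have "ext \<gamma> = U" using assms by (auto simp: ext_def)
  ultimately show ?thesis using that by blast
qed

lemma truth_upI:
  assumes "\<And>\<delta> \<delta>' \<Gamma>. (\<And>z. canon (\<delta> z)) \<Longrightarrow> (\<And>z. canon (\<delta>' z)) \<Longrightarrow> cl \<phi> \<delta> \<subseteq> \<Sigma> \<Longrightarrow>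
    (\<And>z. z \<notin> X \<Longrightarrow> \<delta>' z = \<delta> z) \<Longrightarrow> \<Gamma> \<in> W \<Longrightarrow> mem \<Gamma> (fsubst \<delta>' \<phi>) \<Longrightarrow> c \<Gamma> \<in> Sem \<delta>' \<phi>"
  shows "truth_up X \<phi>"
  unfolding truth_up_def by (intro allI impI ballI, rule assms) auto

lemma truth_upD:
  assumes "truth_up X \<phi>" "\<And>z. canon (\<delta> z)" "\<And>z. canon (\<delta>' z)" "cl \<phi> \<delta> \<subseteq> \<Sigma>"
    "\<And>z. z \<notin> X \<Longrightarrow> \<delta>' z = \<delta> z" "\<Gamma> \<in> W" "mem \<Gamma> (fsubst \<delta>' \<phi>)"
  shows "c \<Gamma> \<in> Sem \<delta>' \<phi>"
  using assms unfolding truth_up_def by blast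

lemma truth_downI:
  assumes "\<And>\<delta> \<delta>' \<Gamma>. (\<And>z. canon (\<delta> z)) \<Longrightarrow> (\<And>z. canon (\<delta>' z)) \<Longrightarrow> cl \<phi> \<delta> \<subseteq> \<Sigma> \<Longrightarrow>
    (\<And>z. z \<notin> X \<Longrightarrow> \<delta>' z = \<delta> z) \<Longrightarrow>
    (\<And>z \<Gamma>. z \<in> X \<Longrightarrow> \<delta>' z \<noteq> \<delta> z \<Longrightarrow> \<Gamma> \<in> W \<Longrightarrow> c \<Gamma> \<in> ext (\<delta>' z) \<Longrightarrow> mem \<Gamma> (\<delta>' z)) \<Longrightarrow>
    \<Gamma> \<in> W \<Longrightarrow> c \<Gamma> \<in> Sem \<delta>' \<phi> \<Longrightarrow> mem \<Gamma> (fsubst \<delta>' \<phi>)"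
  shows "truth_down X \<phi>"
  unfolding truth_down_def by (intro allI impI ballI, rule assms) auto

lemma truth_downD:
  assumes "truth_down X \<phi>" "\<And>z. canon (\<delta> z)" "\<And>z. canon (\<delta>' z)" "cl \<phi> \<delta> \<subseteq> \<Sigma>"
    "\<And>z. z \<notin> X \<Longrightarrow> \<delta>' z = \<delta> z"
    "\<And>z \<Gamma>. z \<in> X \<Longrightarrow> \<delta>' z \<noteq> \<delta> z \<Longrightarrow> \<Gamma> \<in> W \<Longrightarrow> c \<Gamma> \<in> ext (\<delta>' z) \<Longrightarrow> mem \<Gamma> (\<delta>' z)"
    "\<Gamma> \<in> W" "c \<Gamma> \<in> Sem \<delta>' \<phi>"
  shows "mem \<Gamma> (fsubst \<delta>' \<phi>)"
  using assms unfolding truth_down_def by blast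

lemma truth_up_antimono: "truth_up X \<phi> \<Longrightarrow> Y \<subseteq> X \<Longrightarrow> truth_up Y \<phi>"
  by (rule truth_upI, rule truth_upD) (assumption | blast)+

lemma truth_down_antimono: "truth_down X \<phi> \<Longrightarrow> Y \<subseteq> X \<Longrightarrow> truth_down Y \<phi>"
  by (rule truth_downI, rule truth_downD) (assumption | blast)+

lemma Sem_upd: "sem (c ` W) R' ((ext \<circ> \<delta>)(x := ext \<gamma>)) \<phi> = Sem (\<delta>(x := \<gamma>)) \<phi>"
  by (simp add: fun_upd_comp)

text \<open>Two environments are carried because \<open>\<delta>\<close> sends y to its fixpoint
  formula, which keeps the closure inside \<Sigma>, while \<open>\<delta>'\<close> sends y to the
  defining formula \<open>\<gamma>\<close>. As \<open>\<gamma>\<close> denotes the fixpoint, the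
  induction hypothesis at \<open>\<gamma>\<close> is the premise of the least prefixpoint rule at
  every world, hence provable.\<close>

lemma truth_up_Mu:
  assumes "Con {y} \<phi>" "truth_up (X \<union> {y}) \<phi>"
  shows "truth_up X (Mu y \<phi>)"
  unfolding truth_up_def
proof (intro allI impI ballI)
  fix \<delta> \<delta>' \<Gamma>
  assume can: "\<forall>z. canon (\<delta> z)" "\<forall>z. canon (\<delta>' z)" and cl: "cl (Mu y \<phi>) \<delta> \<subseteq> \<Sigma>"
    and eq: "\<forall>z. z \<notin> X \<longrightarrow> \<delta>' z = \<delta> z" and \<Gamma>: "\<Gamma> \<in> W" "mem \<Gamma> (fsubst \<delta>' (Mu y \<phi>))"
  have mc: "mu_c \<phi>" "mu_c (Mu y \<phi>)" using assms(1) by (auto intro: Con_mu_c mu_c_Con_Cocon.intros)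
  obtain \<gamma> where \<gamma>: "canon \<gamma>" "ext \<gamma> = Sem \<delta>' (Mu y \<phi>)"
    "\<And>\<Gamma>. \<Gamma> \<in> W \<Longrightarrow> mem \<Gamma> \<gamma> \<longleftrightarrow> c \<Gamma> \<in> Sem \<delta>' (Mu y \<phi>)"
    using definable_ext sem_subset by metis
  have fp: "Sem (\<delta>'(y := \<gamma>)) \<phi> = ext \<gamma>"
    unfolding Sem_upd[symmetric] unfolding \<gamma>(2) sem.simps by (rule lfp_fixpoint[OF Con_mono[OF assms(1)]])
  have "imp (fsubst (\<delta>'(y := \<gamma>)) \<phi>) \<gamma> \<in> mu_c_logic L"
  proof (subst provable_iff)
    show "canon (fsubst (\<delta>'(y := \<gamma>)) \<phi>)" using can \<gamma>(1) mc by (intro canon_fsubst) auto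
    have "cl \<phi> (\<delta>(y := fsubst \<delta> (Mu y \<phi>))) \<subseteq> \<Sigma>" using cl by simp
    moreover have "\<forall>z. canon ((\<delta>(y := fsubst \<delta> (Mu y \<phi>))) z)"
      using can canon_fsubst[OF mc(2)] by simp
    moreover have "\<forall>z. canon ((\<delta>'(y := \<gamma>)) z)" using can \<gamma>(1) by simp
    moreover have "\<forall>z. z \<notin> X \<union> {y} \<longrightarrow> (\<delta>'(y := \<gamma>)) z = (\<delta>(y := fsubst \<delta> (Mu y \<phi>))) z"
      using eq by simp
    ultimately have "\<forall>\<Gamma>\<in>W. mem \<Gamma> (fsubst (\<delta>'(y := \<gamma>)) \<phi>) \<longrightarrow> c \<Gamma> \<in> Sem (\<delta>'(y := \<gamma>)) \<phi>"
      using assms(2) unfolding truth_up_def by blast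
    then show "\<forall>\<Gamma>\<in>W. mem \<Gamma> (fsubst (\<delta>'(y := \<gamma>)) \<phi>) \<longrightarrow> mem \<Gamma> \<gamma>"
      using fp \<gamma>(2,3) by simp
  qed (rule \<gamma>(1))
  then have "imp (fsubst \<delta>' (Mu y \<phi>)) \<gamma> \<in> mu_c_logic L"
    using mu_c_logic_least[OF assms(1)] can(2) by blast
  then have "mem \<Gamma> \<gamma>" using provable_iff[OF canon_fsubst[OF mc(2)] \<gamma>(1)] can(2) \<Gamma> by blast
  then show "c \<Gamma> \<in> Sem \<delta>' (Mu y \<phi>)" using \<gamma>(3) \<Gamma>(1) by simp
qed

lemma truth_down_Nu:
  assumes "Cocon {y} \<phi>" "truth_down (X \<union> {y}) \<phi>"
  shows "truth_down X (Nu y \<phi>)"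
  unfolding truth_down_def
proof (intro allI impI ballI)
  fix \<delta> \<delta>' \<Gamma>
  assume can: "\<forall>z. canon (\<delta> z)" "\<forall>z. canon (\<delta>' z)" and cl: "cl (Nu y \<phi>) \<delta> \<subseteq> \<Sigma>"
    and eq: "\<forall>z. z \<notin> X \<longrightarrow> \<delta>' z = \<delta> z"
    and sat: "\<forall>z\<in>X. \<delta>' z \<noteq> \<delta> z \<longrightarrow> (\<forall>\<Gamma>\<in>W. c \<Gamma> \<in> ext (\<delta>' z) \<longrightarrow> mem \<Gamma> (\<delta>' z))"
    and \<Gamma>: "\<Gamma> \<in> W" "c \<Gamma> \<in> Sem \<delta>' (Nu y \<phi>)"
  have mc: "mu_c \<phi>" "mu_c (Nu y \<phi>)" using assms(1) by (auto intro: Cocon_mu_c mu_c_Con_Cocon.intros)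
  obtain \<gamma> where \<gamma>: "canon \<gamma>" "ext \<gamma> = Sem \<delta>' (Nu y \<phi>)"
    "\<And>\<Gamma>. \<Gamma> \<in> W \<Longrightarrow> mem \<Gamma> \<gamma> \<longleftrightarrow> c \<Gamma> \<in> Sem \<delta>' (Nu y \<phi>)"
    using definable_ext sem_subset by metis
  have fp: "Sem (\<delta>'(y := \<gamma>)) \<phi> = ext \<gamma>"
    unfolding Sem_upd[symmetric] unfolding \<gamma>(2) sem.simps by (rule gfp_fixpoint[OF Cocon_mono[OF assms(1)]])
  have "imp \<gamma> (fsubst (\<delta>'(y := \<gamma>)) \<phi>) \<in> mu_c_logic L"
  proof (subst provable_iff)
    show "canon (fsubst (\<delta>'(y := \<gamma>)) \<phi>)" using can \<gamma>(1) mc by (intro canon_fsubst) auto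
    have "cl \<phi> (\<delta>(y := fsubst \<delta> (Nu y \<phi>))) \<subseteq> \<Sigma>" using cl by simp
    moreover have "\<forall>z. canon ((\<delta>(y := fsubst \<delta> (Nu y \<phi>))) z)"
      using can canon_fsubst[OF mc(2)] by simp
    moreover have "\<forall>z. canon ((\<delta>'(y := \<gamma>)) z)" using can \<gamma>(1) by simp
    moreover have "\<forall>z. z \<notin> X \<union> {y} \<longrightarrow> (\<delta>'(y := \<gamma>)) z = (\<delta>(y := fsubst \<delta> (Nu y \<phi>))) z"
      using eq by simp
    \<comment> \<open>The new value \<open>\<gamma>\<close> defines a union of classes, so it meets
      the extra condition of \<open>truth_down\<close>.\<close>
    moreover have "\<forall>z\<in>X \<union> {y}. (\<delta>'(y := \<gamma>)) z \<noteq> (\<delta>(y := fsubst \<delta> (Nu y \<phi>))) z \<longrightarrow>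
        (\<forall>\<Gamma>\<in>W. c \<Gamma> \<in> ext ((\<delta>'(y := \<gamma>)) z) \<longrightarrow> mem \<Gamma> ((\<delta>'(y := \<gamma>)) z))"
      using sat \<gamma>(2,3) by auto
    ultimately have "\<forall>\<Gamma>\<in>W. c \<Gamma> \<in> Sem (\<delta>'(y := \<gamma>)) \<phi> \<longrightarrow> mem \<Gamma> (fsubst (\<delta>'(y := \<gamma>)) \<phi>)"
      using assms(2) unfolding truth_down_def by blast
    then show "\<forall>\<Gamma>\<in>W. mem \<Gamma> \<gamma> \<longrightarrow> mem \<Gamma> (fsubst (\<delta>'(y := \<gamma>)) \<phi>)"
      using fp \<gamma>(2,3) by simp
  qed (rule \<gamma>(1))
  then have "imp \<gamma> (fsubst \<delta>' (Nu y \<phi>)) \<in> mu_c_logic L"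
    using mu_c_logic_greatest[OF assms(1)] can(2) by blast
  moreover have "mem \<Gamma> \<gamma>" using \<gamma>(3) \<Gamma> by simp
  ultimately show "mem \<Gamma> (fsubst \<delta>' (Nu y \<phi>))"
    using provable_iff[OF \<gamma>(1) canon_fsubst[OF mc(2)]] can(2) \<Gamma> by blast
qed

text \<open>From membership to truth by \<open>truth_up_Mu\<close> with no displaced variable.
  Conversely the prefixpoint axiom makes \<open>ext ?\<theta>\<close> a prefixpoint in the quotient;
  here the full truth lemma for the body is available, because \<open>?\<theta>\<close> lies in
  \<Sigma>.\<close>

lemma truth_Mu:
  assumes "Con {x} \<phi>" "truth \<phi>" "truth_up {x} \<phi>"
  shows "truth (Mu x \<phi>)"
  unfolding truth_def
proof (intro allI impI ballI iffI)
  fix \<delta> \<Gamma>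
  assume can: "\<forall>z. canon (\<delta> z)" and cl: "cl (Mu x \<phi>) \<delta> \<subseteq> \<Sigma>" and \<Gamma>: "\<Gamma> \<in> W"
  have mc: "mu_c \<phi>" "mu_c (Mu x \<phi>)" using assms(1) by (auto intro: Con_mu_c mu_c_Con_Cocon.intros)
  show "c \<Gamma> \<in> Sem \<delta> (Mu x \<phi>)" if "mem \<Gamma> (fsubst \<delta> (Mu x \<phi>))"
    by (rule truth_upD[OF truth_up_Mu[where X = "{}"], of x \<phi> \<delta>]) (use assms can cl \<Gamma> that in auto)
  let ?\<theta> = "fsubst \<delta> (Mu x \<phi>)"
  have \<theta>: "?\<theta> \<in> \<Sigma>" "canon ?\<theta>" using cl canon_fsubst[OF mc(2)] can by auto
  have can': "\<forall>z. canon ((\<delta>(x := ?\<theta>)) z)" using \<theta> can by simp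
  have "Sem (\<delta>(x := ?\<theta>)) \<phi> \<subseteq> ext ?\<theta>"
  proof
    fix b assume b: "b \<in> Sem (\<delta>(x := ?\<theta>)) \<phi>"
    then obtain \<Delta> where \<Delta>: "\<Delta> \<in> W" "b = c \<Delta>" using subsetD[OF sem_subset b] by blast
    have "mem \<Delta> (fsubst (\<delta>(x := ?\<theta>)) \<phi>)"
      using assms(2) can' cl b \<Delta> unfolding truth_def by auto
    then have "mem \<Delta> ?\<theta>"
      using mu_c_logic_prefix[OF assms(1), of \<delta>] can \<Delta>(1)
        provable_iff[OF canon_fsubst[OF mc(1)] \<theta>(2)] can' by blast
    then show "b \<in> ext ?\<theta>" using \<Delta> ext_intro by simp
  qed
  then have "Sem \<delta> (Mu x \<phi>) \<subseteq> ext ?\<theta>"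
    unfolding Sem_upd[symmetric] sem.simps by (rule lfp_lowerbound)
  then show "mem \<Gamma> ?\<theta>" if "c \<Gamma> \<in> Sem \<delta> (Mu x \<phi>)" using that mem_ext[OF \<theta> \<Gamma>] by blast
qed

lemma truth_Nu:
  assumes "Cocon {x} \<phi>" "truth \<phi>" "truth_down {x} \<phi>"
  shows "truth (Nu x \<phi>)"
  unfolding truth_def
proof (intro allI impI ballI iffI)
  fix \<delta> \<Gamma>
  assume can: "\<forall>z. canon (\<delta> z)" and cl: "cl (Nu x \<phi>) \<delta> \<subseteq> \<Sigma>" and \<Gamma>: "\<Gamma> \<in> W"
  have mc: "mu_c \<phi>" "mu_c (Nu x \<phi>)" using assms(1) by (auto intro: Cocon_mu_c mu_c_Con_Cocon.intros)
  show "mem \<Gamma> (fsubst \<delta> (Nu x \<phi>))" if "c \<Gamma> \<in> Sem \<delta> (Nu x \<phi>)"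
    by (rule truth_downD[OF truth_down_Nu[where X = "{}"], of x \<phi> \<delta>]) (use assms can cl \<Gamma> that in auto)
  let ?\<theta> = "fsubst \<delta> (Nu x \<phi>)"
  have \<theta>: "?\<theta> \<in> \<Sigma>" "canon ?\<theta>" using cl canon_fsubst[OF mc(2)] can by auto
  have can': "\<forall>z. canon ((\<delta>(x := ?\<theta>)) z)" using \<theta> can by simp
  have "ext ?\<theta> \<subseteq> Sem (\<delta>(x := ?\<theta>)) \<phi>"
  proof
    fix b assume "b \<in> ext ?\<theta>"
    then obtain \<Delta> where \<Delta>: "\<Delta> \<in> W" "b = c \<Delta>" "mem \<Delta> ?\<theta>" by (auto simp: ext_def)
    then have "mem \<Delta> (fsubst (\<delta>(x := ?\<theta>)) \<phi>)"
      using mu_c_logic_postfix[OF assms(1), of \<delta>] can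
        provable_iff[OF \<theta>(2) canon_fsubst[OF mc(1)]] can' by blast
    then show "b \<in> Sem (\<delta>(x := ?\<theta>)) \<phi>"
      using assms(2) can' cl \<Delta> unfolding truth_def by auto
  qed
  then have "ext ?\<theta> \<subseteq> Sem \<delta> (Nu x \<phi>)"
    unfolding Sem_upd[symmetric] sem.simps by (rule gfp_upperbound)
  then show "c \<Gamma> \<in> Sem \<delta> (Nu x \<phi>)" if "mem \<Gamma> ?\<theta>" using that ext_intro[OF \<Gamma>] by blast
qed

section \<open>The induction for the truth lemma\<close>

lemma truth_Pos: "truth (Pos p)"
  by (auto simp: truth_def mem_ext)

lemma truth_Neg: "truth (Neg p)"
  by (auto simp: truth_def mem_ext mem_neg)

lemma truth_Or: "mu_c \<phi> \<Longrightarrow> mu_c \<psi> \<Longrightarrow> truth \<phi> \<Longrightarrow> truth \<psi> \<Longrightarrow> truth (Or \<phi> \<psi>)"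
  by (simp add: truth_def mem_Or canon_fsubst)

lemma truth_And: "mu_c \<phi> \<Longrightarrow> mu_c \<psi> \<Longrightarrow> truth \<phi> \<Longrightarrow> truth \<psi> \<Longrightarrow> truth (And \<phi> \<psi>)"
  by (simp add: truth_def mem_And canon_fsubst)

lemma truth_Dia:
  assumes "mu_c \<phi>" "truth \<phi>"
  shows "truth (Dia \<phi>)"
  unfolding truth_def
proof (intro allI impI ballI iffI)
  fix \<delta> \<Gamma>
  assume can: "\<forall>z. canon (\<delta> z)" and cl: "cl (Dia \<phi>) \<delta> \<subseteq> \<Sigma>" and \<Gamma>: "\<Gamma> \<in> W"
  have c\<phi>: "canon (fsubst \<delta> \<phi>)" using assms(1) can by (intro canon_fsubst) auto
  have IH: "mem \<Delta> (fsubst \<delta> \<phi>) \<longleftrightarrow> c \<Delta> \<in> Sem \<delta> \<phi>" if "\<Delta> \<in> W" for \<Delta>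
    using assms(2) can cl that unfolding truth_def by simp
  show "c \<Gamma> \<in> Sem \<delta> (Dia \<phi>)" if "mem \<Gamma> (fsubst \<delta> (Dia \<phi>))"
    using that mem_Dia[OF \<Gamma> c\<phi>] R'_min[OF \<Gamma>] IH \<Gamma> by auto
  assume "c \<Gamma> \<in> Sem \<delta> (Dia \<phi>)"
  then obtain b where b: "(c \<Gamma>, b) \<in> R'" "b \<in> Sem \<delta> \<phi>" by auto
  then obtain \<Delta> where \<Delta>: "\<Delta> \<in> W" "b = c \<Delta>" using R'_subset by blast
  then have "mem \<Gamma> (Dia (fsubst \<delta> \<phi>))"
    using R'_Dia[OF \<Gamma> \<Delta>(1) _ c\<phi>] IH[OF \<Delta>(1)] b cl by simp
  then show "mem \<Gamma> (fsubst \<delta> (Dia \<phi>))" by simp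
qed

lemma truth_Box:
  assumes "mu_c \<phi>" "truth \<phi>"
  shows "truth (Box \<phi>)"
  unfolding truth_def
proof (intro allI impI ballI iffI)
  fix \<delta> \<Gamma>
  assume can: "\<forall>z. canon (\<delta> z)" and cl: "cl (Box \<phi>) \<delta> \<subseteq> \<Sigma>" and \<Gamma>: "\<Gamma> \<in> W"
  have c\<phi>: "canon (fsubst \<delta> \<phi>)" using assms(1) can by (intro canon_fsubst) auto
  have IH: "mem \<Delta> (fsubst \<delta> \<phi>) \<longleftrightarrow> c \<Delta> \<in> Sem \<delta> \<phi>" if "\<Delta> \<in> W" for \<Delta>
    using assms(2) can cl that unfolding truth_def by simp
  show "mem \<Gamma> (fsubst \<delta> (Box \<phi>))" if "c \<Gamma> \<in> Sem \<delta> (Box \<phi>)"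
    using that mem_Box[OF \<Gamma> c\<phi>] R'_min[OF \<Gamma>] IH by auto
  assume m: "mem \<Gamma> (fsubst \<delta> (Box \<phi>))"
  have "b \<in> Sem \<delta> \<phi>" if b: "(c \<Gamma>, b) \<in> R'" for b
  proof -
    obtain \<Delta> where \<Delta>: "\<Delta> \<in> W" "b = c \<Delta>" using b R'_subset by blast
    then show ?thesis using R'_Box[OF \<Gamma> \<Delta>(1) _ c\<phi>] IH[OF \<Delta>(1)] b cl m by simp
  qed
  then show "c \<Gamma> \<in> Sem \<delta> (Box \<phi>)" using \<Gamma> by simp
qed

text \<open>The displaced values sit on variables that do not occur free, so
  \<open>\<delta>'\<close> can be exchanged for \<open>\<delta>\<close> and the full truth lemma
  applies.\<close>

lemma
  assumes "truth \<phi>" "FV \<phi> \<inter> X = {}"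
  shows truth_up_free: "truth_up X \<phi>" and truth_down_free: "truth_down X \<phi>"
proof -
  have "mem \<Gamma> (fsubst \<delta>' \<phi>) \<longleftrightarrow> c \<Gamma> \<in> Sem \<delta>' \<phi>"
    if "\<And>z. canon (\<delta> z)" "cl \<phi> \<delta> \<subseteq> \<Sigma>" "\<And>z. z \<notin> X \<Longrightarrow> \<delta>' z = \<delta> z" "\<Gamma> \<in> W" for \<delta> \<delta>' \<Gamma>
  proof -
    have eq: "\<delta>' z = \<delta> z" if "z \<in> FV \<phi>" for z using that assms(2) \<open>\<And>z. z \<notin> X \<Longrightarrow> \<delta>' z = \<delta> z\<close> by blast
    have "fsubst \<delta>' \<phi> = fsubst \<delta> \<phi>" using eq by (rule fsubst_cong)
    moreover have "Sem \<delta>' \<phi> = Sem \<delta> \<phi>" by (rule sem_cong) (simp add: eq)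
    ultimately show ?thesis using assms(1) that(1,2,4) unfolding truth_def by simp
  qed
  then show "truth_up X \<phi>" "truth_down X \<phi>" by - (rule truth_upI truth_downI; blast)+
qed

text \<open>Full and one-sided truth are proved together: a fixpoint over a body needs both for that
  body, and X-free subformulas turn the full version back into a one-sided one.\<close>

lemma truth_mu_c: "mu_c \<phi> \<Longrightarrow> truth \<phi>"
  and truth_Con: "Con X \<phi> \<Longrightarrow> truth \<phi> \<and> truth_up X \<phi>"
  and truth_Cocon: "Cocon X \<phi> \<Longrightarrow> truth \<phi> \<and> truth_down X \<phi>"
proof (induction rule: mu_c_Con_Cocon.inducts)
  case (Con_var x X)
  show ?case by (auto intro!: truth_Pos truth_upI ext_intro)
next
  case (Con_free \<phi> X)
  then show ?case by (blast intro: truth_up_free)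
next
  case (Con_Or X \<phi> \<psi>)
  then have mc: "mu_c \<phi>" "mu_c \<psi>" by (auto intro: Con_mu_c)
  have "truth_up X (Or \<phi> \<psi>)"
  proof (rule truth_upI)
    fix \<delta> \<delta>' \<Gamma>
    assume *: "\<And>z. canon (\<delta> z)" "\<And>z. canon (\<delta>' z)" "cl (Or \<phi> \<psi>) \<delta> \<subseteq> \<Sigma>"
      "\<And>z. z \<notin> X \<Longrightarrow> \<delta>' z = \<delta> z" "\<Gamma> \<in> W" "mem \<Gamma> (fsubst \<delta>' (Or \<phi> \<psi>))"
    then show "c \<Gamma> \<in> Sem \<delta>' (Or \<phi> \<psi>)"
      using truth_upD[of X \<phi> \<delta> \<delta>' \<Gamma>] truth_upD[of X \<psi> \<delta> \<delta>' \<Gamma>] Con_Or.IH mc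
      by (auto simp: mem_Or canon_fsubst)
  qed
  then show ?case using truth_Or mc Con_Or.IH by blast
next
  case (Con_And X \<phi> \<psi>)
  then have mc: "mu_c \<phi>" "mu_c \<psi>" by (auto intro: Con_mu_c)
  have "truth_up X (And \<phi> \<psi>)"
  proof (rule truth_upI)
    fix \<delta> \<delta>' \<Gamma>
    assume *: "\<And>z. canon (\<delta> z)" "\<And>z. canon (\<delta>' z)" "cl (And \<phi> \<psi>) \<delta> \<subseteq> \<Sigma>"
      "\<And>z. z \<notin> X \<Longrightarrow> \<delta>' z = \<delta> z" "\<Gamma> \<in> W" "mem \<Gamma> (fsubst \<delta>' (And \<phi> \<psi>))"
    then show "c \<Gamma> \<in> Sem \<delta>' (And \<phi> \<psi>)"
      using truth_upD[of X \<phi> \<delta> \<delta>' \<Gamma>] truth_upD[of X \<psi> \<delta> \<delta>' \<Gamma>] Con_And.IH mc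
      by (auto simp: mem_And canon_fsubst)
  qed
  then show ?case using truth_And mc Con_And.IH by blast
next
  case (Con_Dia X \<phi>)
  then have mc: "mu_c \<phi>" by (auto intro: Con_mu_c)
  have "truth_up X (Dia \<phi>)"
  proof (rule truth_upI)
    fix \<delta> \<delta>' \<Gamma>
    assume *: "\<And>z. canon (\<delta> z)" "\<And>z. canon (\<delta>' z)" "cl (Dia \<phi>) \<delta> \<subseteq> \<Sigma>"
      "\<And>z. z \<notin> X \<Longrightarrow> \<delta>' z = \<delta> z" "\<Gamma> \<in> W" "mem \<Gamma> (fsubst \<delta>' (Dia \<phi>))"
    then obtain \<Delta> where \<Delta>: "\<Delta> \<in> W" "(\<Gamma>, \<Delta>) \<in> R" "mem \<Delta> (fsubst \<delta>' \<phi>)"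
      using mem_Dia[of \<Gamma> "fsubst \<delta>' \<phi>"] mc by (auto simp: canon_fsubst)
    then have "c \<Delta> \<in> Sem \<delta>' \<phi>"
      using truth_upD[of X \<phi> \<delta> \<delta>' \<Delta>] Con_Dia.IH * by simp
    \<comment> \<open>Only \<open>R'_min\<close> is used. A box here would need
      \<open>R'_Box\<close> for a formula that may lie outside \<Sigma>.\<close>
    then show "c \<Gamma> \<in> Sem \<delta>' (Dia \<phi>)" using R'_min \<Delta> *(5) by auto
  qed
  then show ?case using truth_Dia mc Con_Dia.IH by blast
next
  case (Con_Mu X y \<phi>)
  then show ?case
    \<comment> \<open>The whole set \<open>X \<union> {y}\<close> serves the one-sided claim, its
      restriction to y the full one.\<close>
    using Con_singleton truth_up_Mu truth_Mu truth_up_antimono[of "X \<union> {y}" \<phi> "{y}"] by blast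
next
  case (Cocon_var x X)
  have "truth_down X (Pos x)"
  proof (rule truth_downI)
    fix \<delta> \<delta>' \<Gamma>
    assume *: "\<And>z. canon (\<delta> z)" "cl (Pos x) \<delta> \<subseteq> \<Sigma>"
      "\<And>z \<Gamma>. z \<in> X \<Longrightarrow> \<delta>' z \<noteq> \<delta> z \<Longrightarrow> \<Gamma> \<in> W \<Longrightarrow> c \<Gamma> \<in> ext (\<delta>' z) \<Longrightarrow> mem \<Gamma> (\<delta>' z)"
      "\<Gamma> \<in> W" "c \<Gamma> \<in> Sem \<delta>' (Pos x)"
    then show "mem \<Gamma> (fsubst \<delta>' (Pos x))"
      using Cocon_var mem_ext[of "\<delta> x" \<Gamma>] by (cases "\<delta>' x = \<delta> x") auto
  qed
  then show ?case using truth_Pos by simp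
next
  case (Cocon_free \<phi> X)
  then show ?case by (blast intro: truth_down_free)
next
  case (Cocon_Or X \<phi> \<psi>)
  then have mc: "mu_c \<phi>" "mu_c \<psi>" by (auto intro: Cocon_mu_c)
  have "truth_down X (Or \<phi> \<psi>)"
  proof (rule truth_downI)
    fix \<delta> \<delta>' \<Gamma>
    assume *: "\<And>z. canon (\<delta> z)" "\<And>z. canon (\<delta>' z)" "cl (Or \<phi> \<psi>) \<delta> \<subseteq> \<Sigma>"
      "\<And>z. z \<notin> X \<Longrightarrow> \<delta>' z = \<delta> z"
      "\<And>z \<Gamma>. z \<in> X \<Longrightarrow> \<delta>' z \<noteq> \<delta> z \<Longrightarrow> \<Gamma> \<in> W \<Longrightarrow> c \<Gamma> \<in> ext (\<delta>' z) \<Longrightarrow> mem \<Gamma> (\<delta>' z)"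
      "\<Gamma> \<in> W" "c \<Gamma> \<in> Sem \<delta>' (Or \<phi> \<psi>)"
    have "c \<Gamma> \<in> Sem \<delta>' \<phi> \<Longrightarrow> mem \<Gamma> (fsubst \<delta>' \<phi>)" "c \<Gamma> \<in> Sem \<delta>' \<psi> \<Longrightarrow> mem \<Gamma> (fsubst \<delta>' \<psi>)"
      using truth_downD[OF _ *(1,2) _ *(4,5,6)] Cocon_Or.IH *(3) by auto
    then show "mem \<Gamma> (fsubst \<delta>' (Or \<phi> \<psi>))" using * mc by (auto simp: mem_Or canon_fsubst)
  qed
  then show ?case using truth_Or mc Cocon_Or.IH by blast
next
  case (Cocon_And X \<phi> \<psi>)
  then have mc: "mu_c \<phi>" "mu_c \<psi>" by (auto intro: Cocon_mu_c)
  have "truth_down X (And \<phi> \<psi>)"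
  proof (rule truth_downI)
    fix \<delta> \<delta>' \<Gamma>
    assume *: "\<And>z. canon (\<delta> z)" "\<And>z. canon (\<delta>' z)" "cl (And \<phi> \<psi>) \<delta> \<subseteq> \<Sigma>"
      "\<And>z. z \<notin> X \<Longrightarrow> \<delta>' z = \<delta> z"
      "\<And>z \<Gamma>. z \<in> X \<Longrightarrow> \<delta>' z \<noteq> \<delta> z \<Longrightarrow> \<Gamma> \<in> W \<Longrightarrow> c \<Gamma> \<in> ext (\<delta>' z) \<Longrightarrow> mem \<Gamma> (\<delta>' z)"
      "\<Gamma> \<in> W" "c \<Gamma> \<in> Sem \<delta>' (And \<phi> \<psi>)"
    have "c \<Gamma> \<in> Sem \<delta>' \<phi> \<Longrightarrow> mem \<Gamma> (fsubst \<delta>' \<phi>)" "c \<Gamma> \<in> Sem \<delta>' \<psi> \<Longrightarrow> mem \<Gamma> (fsubst \<delta>' \<psi>)"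
      using truth_downD[OF _ *(1,2) _ *(4,5,6)] Cocon_And.IH *(3) by auto
    then show "mem \<Gamma> (fsubst \<delta>' (And \<phi> \<psi>))" using * mc by (auto simp: mem_And canon_fsubst)
  qed
  then show ?case using truth_And mc Cocon_And.IH by blast
next
  case (Cocon_Box X \<phi>)
  then have mc: "mu_c \<phi>" by (auto intro: Cocon_mu_c)
  have "truth_down X (Box \<phi>)"
  proof (rule truth_downI)
    fix \<delta> \<delta>' \<Gamma>
    assume *: "\<And>z. canon (\<delta> z)" "\<And>z. canon (\<delta>' z)" "cl (Box \<phi>) \<delta> \<subseteq> \<Sigma>"
      "\<And>z. z \<notin> X \<Longrightarrow> \<delta>' z = \<delta> z"
      "\<And>z \<Gamma>. z \<in> X \<Longrightarrow> \<delta>' z \<noteq> \<delta> z \<Longrightarrow> \<Gamma> \<in> W \<Longrightarrow> c \<Gamma> \<in> ext (\<delta>' z) \<Longrightarrow> mem \<Gamma> (\<delta>' z)"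
      "\<Gamma> \<in> W" "c \<Gamma> \<in> Sem \<delta>' (Box \<phi>)"
    \<comment> \<open>Dual to the diamond: truth at all successors in the quotient is applied to the
      images of successors in W, again through \<open>R'_min\<close> alone.\<close>
    have "mem \<Delta> (fsubst \<delta>' \<phi>)" if "\<Delta> \<in> W" "(\<Gamma>, \<Delta>) \<in> R" for \<Delta>
      using truth_downD[OF _ *(1,2) _ *(4,5) that(1)] Cocon_Box.IH *(3,6,7) R'_min that by auto
    then show "mem \<Gamma> (fsubst \<delta>' (Box \<phi>))" using * mc mem_Box by (auto simp: canon_fsubst)
  qed
  then show ?case using truth_Box mc Cocon_Box.IH by blast
next
  case (Cocon_Nu X y \<phi>)
  then show ?case
    using Cocon_singleton truth_down_Nu truth_Nu truth_down_antimono[of "X \<union> {y}" \<phi> "{y}"] by blast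
qed (auto intro: truth_Pos truth_Neg truth_Or truth_And truth_Dia truth_Box truth_Mu truth_Nu)

lemma truth_lemma:
  assumes "mu_c \<phi>" "cl \<phi> Pos \<subseteq> \<Sigma>" "\<Gamma> \<in> W"
  shows "mem \<Gamma> (fsubst Pos \<phi>) \<longleftrightarrow> c \<Gamma> \<in> Sem Pos \<phi>"
  using truth_mu_c[OF assms(1)] assms(2,3)
  unfolding truth_def by (auto simp: canon_def intro: mu_c_Con_Cocon.intros)

end

section \<open>Provable renaming of bound variables\<close>

lemma mu_c_logic_taut_inst:
  assumes "tautology \<tau>" "mu_c a" "mu_c b" "mu_c c" "mu_c d"
  shows "fsubst (\<lambda>n. if n = 0 then a else if n = 1 then b else if n = 2 then c else d) \<tau> \<in> mu_c_logic L"
  using assms by (intro mu_c_logic.usubst mu_c_logic.taut) auto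

text \<open>The truth lemma speaks of \<open>fsubst Pos \<phi>\<close>, so a non-theorem must stay
  one after renaming. At binders the axiom of one variant is exactly the premise of the fixpoint
  rule for the other.\<close>

lemma mu_c_logic_renaming: "mu_c \<phi> \<Longrightarrow> imp (fsubst Pos \<phi>) \<phi> \<in> mu_c_logic L"
proof (induction rule: mu_c_Con_Cocon.inducts(1)[where ?P2.0 = "\<lambda>_ _. True" and ?P3.0 = "\<lambda>_ _. True"])
  case (mu_c_Pos p)
  show ?case
    using mu_c_logic_taut_inst[of "imp (Pos 0) (Pos 0)" "Pos p" "Pos p" "Pos p" "Pos p" L]
    by (simp add: tautology_def imp_def mu_c_Con_Cocon.intros)
next
  case (mu_c_Neg p)
  show ?case
    using mu_c_logic_taut_inst[of "imp (Pos 0) (Pos 0)" "Neg p" "Neg p" "Neg p" "Neg p" L]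
    by (simp add: tautology_def imp_def mu_c_Con_Cocon.intros)
next
  case (mu_c_Or \<phi> \<psi>)
  have "mu_c (fsubst Pos \<phi>)" "mu_c (fsubst Pos \<psi>)"
    using mu_c_Or by (auto intro: mu_c_fsubst mu_c_Con_Cocon.intros)
  then have "imp (imp (fsubst Pos \<phi>) \<phi>) (imp (imp (fsubst Pos \<psi>) \<psi>)
      (imp (fsubst Pos (Or \<phi> \<psi>)) (Or \<phi> \<psi>))) \<in> mu_c_logic L"
    using mu_c_logic_taut_inst[of "imp (imp (Pos 0) (Pos 1)) (imp (imp (Pos 2) (Pos 3))
      (imp (Or (Pos 0) (Pos 2)) (Or (Pos 1) (Pos 3))))"
      "fsubst Pos \<phi>" \<phi> "fsubst Pos \<psi>" \<psi> L] mu_c_Or.hyps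
    by (auto simp: tautology_def imp_def neg_fsubst)
  then show ?case using mu_c_Or.IH by (blast intro: mu_c_logic.mp)
next
  case (mu_c_And \<phi> \<psi>)
  have "mu_c (fsubst Pos \<phi>)" "mu_c (fsubst Pos \<psi>)"
    using mu_c_And by (auto intro: mu_c_fsubst mu_c_Con_Cocon.intros)
  then have "imp (imp (fsubst Pos \<phi>) \<phi>) (imp (imp (fsubst Pos \<psi>) \<psi>)
      (imp (fsubst Pos (And \<phi> \<psi>)) (And \<phi> \<psi>))) \<in> mu_c_logic L"
    using mu_c_logic_taut_inst[of "imp (imp (Pos 0) (Pos 1)) (imp (imp (Pos 2) (Pos 3))
      (imp (And (Pos 0) (Pos 2)) (And (Pos 1) (Pos 3))))"
      "fsubst Pos \<phi>" \<phi> "fsubst Pos \<psi>" \<psi> L] mu_c_And.hyps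
    by (auto simp: tautology_def imp_def neg_fsubst)
  then show ?case using mu_c_And.IH by (blast intro: mu_c_logic.mp)
next
  case (mu_c_Dia \<phi>)
  then show ?case by (simp add: mu_c_logic.Dia_mono)
next
  case (mu_c_Box \<phi>)
  then show ?case by (simp add: mu_c_logic.Box_mono)
next
  case (mu_c_Mu x \<phi>)
  then show ?case
    using mu_c_logic_least[of x \<phi> Pos "Mu x \<phi>"] mu_c_logic.Mu_prefix[of x \<phi>]
    by (auto simp: subst1_def canon_def intro: mu_c_Con_Cocon.intros)
next
  case (mu_c_Nu x \<phi>)
  show ?case
    by (rule mu_c_logic.Nu_greatest)
      (use mu_c_Nu mu_c_logic_postfix[of x \<phi> Pos]
        in \<open>auto simp: subst1_def canon_def intro: mu_c_Con_Cocon.intros\<close>)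
qed auto

section \<open>The canonical model of the fixpoint logic\<close>

instance form :: countable
  by countable_datatype

lemma canon_Pos [simp]: "canon (Pos p)"
  by (simp add: canon_def mu_c_Con_Cocon.intros)

text \<open>Assigns to each variable the formula it names. Codes of other formulas fall back on
  \<open>Pos 0\<close>, so that \<open>enum\<close> is a legitimate substitution for
  \<open>usubst\<close> and still reaches every \<open>canon\<close> formula.\<close>

definition enum :: "var \<Rightarrow> form" where
  "enum n = (if canon (from_nat n) then from_nat n else Pos 0)"

lemma canon_enum [simp]: "canon (enum n)"
  by (simp add: enum_def)

lemma mu_c_enum [simp]: "mu_c (enum n)"
  using canon_enum by (simp add: canon_def del: canon_enum)

definition code :: "form \<Rightarrow> var" where
  "code = inv enum"

lemma enum_code: "canon a \<Longrightarrow> enum (code a) = a"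
  unfolding code_def
  by (rule f_inv_into_f) (auto simp: enum_def image_iff intro!: exI[of _ "to_nat a"])

section \<open>Copies of generated subframes along injections\<close>

lemma sem_image:
  assumes "inj_on f S0" "S0 \<subseteq> S" "\<And>s t. s \<in> S0 \<Longrightarrow> (s, t) \<in> R \<Longrightarrow> t \<in> S0"
    and "basic \<phi>" "s \<in> S0"
  shows "f s \<in> sem (f ` S0) (map_prod f f ` (R \<inter> S0 \<times> S0)) V \<phi> \<longleftrightarrow> s \<in> sem S R (\<lambda>p. f -` V p) \<phi>"
proof -
  have R: "(f s, b) \<in> map_prod f f ` (R \<inter> S0 \<times> S0) \<longleftrightarrow> (\<exists>t\<in>S0. b = f t \<and> (s, t) \<in> R)"
    if "s \<in> S0" for s b
    using inj_onD[OF assms(1)] that by fastforce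
  show ?thesis
    using assms(4,5)
  proof (induction \<phi> arbitrary: s)
    case (Dia \<phi>)
    have "f s \<in> sem (f ` S0) (map_prod f f ` (R \<inter> S0 \<times> S0)) V (Dia \<phi>)
        \<longleftrightarrow> (\<exists>t\<in>S0. (s, t) \<in> R \<and> f t \<in> sem (f ` S0) (map_prod f f ` (R \<inter> S0 \<times> S0)) V \<phi>)"
      using Dia.prems(2) by (auto simp: R)
    also have "\<dots> \<longleftrightarrow> (\<exists>t\<in>S0. (s, t) \<in> R \<and> t \<in> sem S R (\<lambda>p. f -` V p) \<phi>)"
      using Dia by simp
    also have "\<dots> \<longleftrightarrow> s \<in> sem S R (\<lambda>p. f -` V p) (Dia \<phi>)"
      using Dia.prems(2) assms(2) assms(3)[OF Dia.prems(2)] by auto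
    finally show ?case .
  next
    case (Box \<phi>)
    have "f s \<in> sem (f ` S0) (map_prod f f ` (R \<inter> S0 \<times> S0)) V (Box \<phi>)
        \<longleftrightarrow> (\<forall>t\<in>S0. (s, t) \<in> R \<longrightarrow> f t \<in> sem (f ` S0) (map_prod f f ` (R \<inter> S0 \<times> S0)) V \<phi>)"
      using Box.prems(2) by (auto simp: R)
    also have "\<dots> \<longleftrightarrow> (\<forall>t\<in>S0. (s, t) \<in> R \<longrightarrow> t \<in> sem S R (\<lambda>p. f -` V p) \<phi>)"
      using Box by simp
    also have "\<dots> \<longleftrightarrow> s \<in> sem S R (\<lambda>p. f -` V p) (Box \<phi>)"
      using Box.prems(2) assms(2) assms(3)[OF Box.prems(2)] by auto
    finally show ?case .
  qed (use assms(2) in auto)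
qed

text \<open>Serves twice: to move the generated subframe of the canonical frame into the given type
  of states, and to bring the quotient back from sets of states to states.\<close>

lemma Fr_image:
  assumes "(S, R) \<in> Fr L" "\<forall>\<phi>\<in>L. basic \<phi>"
    and "inj_on f S0" "S0 \<subseteq> S" "\<And>s t. s \<in> S0 \<Longrightarrow> (s, t) \<in> R \<Longrightarrow> t \<in> S0"
  shows "(f ` S0, map_prod f f ` (R \<inter> S0 \<times> S0)) \<in> Fr L"
  unfolding Fr_def is_frame_def valid_in_def
proof (intro CollectI conjI ballI allI)
  fix \<phi> V b assume \<phi>: "\<phi> \<in> L" and "b \<in> fst (f ` S0, map_prod f f ` (R \<inter> S0 \<times> S0))"
  then obtain s where s: "s \<in> S0" "b = f s" by auto
  have "f s \<in> sem (f ` S0) (map_prod f f ` (R \<inter> S0 \<times> S0)) V \<phi>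
      \<longleftrightarrow> s \<in> sem S R (\<lambda>p. f -` V p) \<phi>"
    by (rule sem_image[OF assms(3,4)]) (use assms(2) \<phi> s in \<open>blast intro: assms(5)\<close>)+
  moreover have "s \<in> sem S R (\<lambda>p. f -` V p) \<phi>"
    using assms(1,4) \<phi> s by (auto simp: Fr_def valid_in_def)
  ultimately show "b \<in> sem (fst (f ` S0, map_prod f f ` (R \<inter> S0 \<times> S0)))
      (snd (f ` S0, map_prod f f ` (R \<inter> S0 \<times> S0))) V \<phi>"
    using s by simp
qed auto

context normal_logic
begin

text \<open>A basic formula \<open>\<theta>\<close> stands for \<open>fsubst enum \<theta>\<close>; in this way maximal consistent sets of basic
  formulas also serve as maximal consistent sets of formulas of the continuous mu-calculus.\<close>

definition T :: "form set" where
  "T = {\<theta>. basic \<theta> \<and> fsubst enum \<theta> \<in> mu_c_logic L}"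

definition worlds :: "form set set" where
  "worlds = {\<Gamma>. max_consistent L \<Gamma> \<and> T \<subseteq> \<Gamma>}"

text \<open>Several basic formulas may translate to the same formula, hence the existential;
  \<open>mem_fsubst\<close> shows that all of them agree in every world.\<close>

definition mem :: "form set \<Rightarrow> form \<Rightarrow> bool" where
  "mem \<Gamma> a \<longleftrightarrow> (\<exists>\<theta>\<in>\<Gamma>. fsubst enum \<theta> = a)"

abbreviation acc :: "(form set \<times> form set) set" where
  "acc \<equiv> snd (canonical_frame L)"

lemma L_subset_T: "L \<subseteq> T"
  by (auto simp: T_def L_basic intro: mu_c_logic.intros)

lemma T_mp: "imp a b \<in> T \<Longrightarrow> a \<in> T \<Longrightarrow> b \<in> T"
  by (auto simp: T_def intro: mu_c_logic.mp)

lemma Cn_T: "\<theta> \<in> Cn L T \<Longrightarrow> \<theta> \<in> T"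
  by (induction rule: Cn.induct) (use L_subset_T T_mp in auto)

text \<open>The fixpoint logic has monotonicity instead of necessitation; the latter is recovered by
  applying it to \<open>imp verum \<theta>\<close>. This makes \<open>worlds\<close> closed under
  canonical successors.\<close>

lemma T_nec:
  assumes "\<theta> \<in> T"
  shows "Box \<theta> \<in> T"
proof -
  have b: "basic \<theta>" using assms by (simp add: T_def)
  have "imp verum \<theta> \<in> T"
    using T_mp[OF _ assms] taut_K[OF b L_basic[OF taut_verum]] L_subset_T by blast
  then have "imp (Box verum) (Box \<theta>) \<in> T"
    by (simp add: T_def mu_c_logic.Box_mono)
  moreover have "Box verum \<in> T" using L_nec[OF taut_verum] L_subset_T by blast
  ultimately show ?thesis by (rule T_mp)
qed

lemma worlds_mcs: "\<Gamma> \<in> worlds \<Longrightarrow> max_consistent L \<Gamma>"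
  by (simp add: worlds_def)

lemma acc_worlds: "\<Gamma> \<in> worlds \<Longrightarrow> (\<Gamma>, \<Delta>) \<in> acc \<Longrightarrow> \<Delta> \<in> worlds"
  using T_nec by (auto simp: worlds_def canonical_frame_def)

text \<open>T contains L and is closed under detachment, so the Lindenbaum lemma for L itself
  separates T from any other basic formula.\<close>

lemma T_iff:
  assumes "basic \<theta>"
  shows "\<theta> \<in> T \<longleftrightarrow> (\<forall>\<Gamma>\<in>worlds. \<theta> \<in> \<Gamma>)"
proof
  assume all: "\<forall>\<Gamma>\<in>worlds. \<theta> \<in> \<Gamma>"
  have T: "T \<subseteq> Collect basic" by (auto simp: T_def)
  have "falsum \<in> Cn L (insert (neg \<theta>) T)"
  proof (rule ccontr)
    assume "falsum \<notin> Cn L (insert (neg \<theta>) T)"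
    then obtain \<Gamma> where "insert (neg \<theta>) T \<subseteq> \<Gamma>" "max_consistent L \<Gamma>"
      using lindenbaum[of "insert (neg \<theta>) T"] T assms by auto
    then show False using all mcs_neg[of \<Gamma> \<theta>] assms by (auto simp: worlds_def)
  qed
  then have "imp (neg \<theta>) falsum \<in> T" using deduction T assms Cn_T by simp
  then show "\<theta> \<in> T" using taut_falsum[of "neg \<theta>"] assms L_subset_T T_mp by auto
qed (auto simp: worlds_def)

text \<open>If two basic formulas have the same translation, the implication between them translates
  to an instance of \<open>imp a a\<close>, so it belongs to T and hence to every world.\<close>

lemma mem_fsubst:
  assumes "\<Gamma> \<in> worlds" "basic \<theta>"
  shows "mem \<Gamma> (fsubst enum \<theta>) \<longleftrightarrow> \<theta> \<in> \<Gamma>"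
proof
  assume "mem \<Gamma> (fsubst enum \<theta>)"
  then obtain \<theta>' where \<theta>': "\<theta>' \<in> \<Gamma>" "fsubst enum \<theta>' = fsubst enum \<theta>" by (auto simp: mem_def)
  then have "basic \<theta>'" using mcs_basic worlds_mcs assms(1) by blast
  then have "imp \<theta>' \<theta>' \<in> T" using taut_I L_subset_T by blast
  then have "imp \<theta>' \<theta> \<in> T" using \<theta>'(2) assms(2) by (simp add: T_def)
  then show "\<theta> \<in> \<Gamma>" using mcs_mp[of \<Gamma> \<theta>' \<theta>] \<theta>'(1) assms(1) by (auto simp: worlds_def)
qed (auto simp: mem_def)

lemma mem_code: "\<Gamma> \<in> worlds \<Longrightarrow> canon a \<Longrightarrow> mem \<Gamma> a \<longleftrightarrow> Pos (code a) \<in> \<Gamma>"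
  using mem_fsubst[of \<Gamma> "Pos (code a)"] by (simp add: enum_code)

lemma mem_code_simps:
  assumes "\<Gamma> \<in> worlds" "canon a" "canon b"
  shows "mem \<Gamma> (neg a) \<longleftrightarrow> neg (Pos (code a)) \<in> \<Gamma>"
    and "mem \<Gamma> (Or a b) \<longleftrightarrow> Or (Pos (code a)) (Pos (code b)) \<in> \<Gamma>"
    and "mem \<Gamma> (And a b) \<longleftrightarrow> And (Pos (code a)) (Pos (code b)) \<in> \<Gamma>"
    and "mem \<Gamma> (Dia a) \<longleftrightarrow> Dia (Pos (code a)) \<in> \<Gamma>"
    and "mem \<Gamma> (Box a) \<longleftrightarrow> Box (Pos (code a)) \<in> \<Gamma>"
  using assms mem_fsubst[OF assms(1), of "neg (Pos (code a))"]
    mem_fsubst[OF assms(1), of "Or (Pos (code a)) (Pos (code b))"]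
    mem_fsubst[OF assms(1), of "And (Pos (code a)) (Pos (code b))"]
    mem_fsubst[OF assms(1), of "Dia (Pos (code a))"]
    mem_fsubst[OF assms(1), of "Box (Pos (code a))"]
  by (simp_all add: enum_code)

lemma imp_provable_iff:
  assumes "canon a" "canon b"
  shows "imp a b \<in> mu_c_logic L \<longleftrightarrow> (\<forall>\<Gamma>\<in>worlds. mem \<Gamma> a \<longrightarrow> mem \<Gamma> b)"
proof -
  let ?i = "imp (Pos (code a)) (Pos (code b))"
  have "imp a b \<in> mu_c_logic L \<longleftrightarrow> ?i \<in> T" using assms by (simp add: T_def enum_code)
  also have "\<dots> \<longleftrightarrow> (\<forall>\<Gamma>\<in>worlds. ?i \<in> \<Gamma>)" by (simp add: T_iff)
  also have "\<dots> \<longleftrightarrow> (\<forall>\<Gamma>\<in>worlds. mem \<Gamma> a \<longrightarrow> mem \<Gamma> b)"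
    using assms by (simp add: mcs_imp worlds_mcs mem_code)
  finally show ?thesis .
qed

text \<open>A disjunctive normal form over F, built by splitting on one formula at a time.\<close>

lemma worlds_definable:
  assumes "finite F" "\<forall>\<theta>\<in>F. basic \<theta>"
    and "\<And>\<Gamma> \<Delta>. \<Gamma> \<in> worlds \<Longrightarrow> \<Delta> \<in> worlds \<Longrightarrow> (\<forall>\<theta>\<in>F. \<theta> \<in> \<Gamma> \<longleftrightarrow> \<theta> \<in> \<Delta>) \<Longrightarrow> \<Gamma> \<in> A \<Longrightarrow> \<Delta> \<in> A"
  shows "\<exists>\<theta>. basic \<theta> \<and> (\<forall>\<Gamma>\<in>worlds. \<theta> \<in> \<Gamma> \<longleftrightarrow> \<Gamma> \<in> A)"
  using assms
proof (induction arbitrary: A rule: finite_induct)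
  case empty
  have "worlds \<subseteq> A \<or> worlds \<inter> A = {}" using empty by blast
  moreover have "basic verum" "\<forall>\<Gamma>\<in>worlds. verum \<in> \<Gamma>"
    using L_basic[OF taut_verum] mcs_L[OF _ taut_verum] worlds_mcs by auto
  moreover from this have "basic (neg verum)" "\<forall>\<Gamma>\<in>worlds. neg verum \<notin> \<Gamma>"
    using mcs_neg worlds_mcs by auto
  ultimately show ?case by (metis disjoint_iff subsetD)
next
  case (insert f F)
  have f: "basic f" using insert.prems by simp
  \<comment> \<open>Those worlds that F cannot tell apart from some member of A on which f has the
    prescribed value: this set depends on F alone, as the induction hypothesis demands.\<close>
  define A' where "A' P = {\<Gamma> \<in> worlds. \<exists>\<Delta>\<in>worlds \<inter> A. P (f \<in> \<Delta>) \<and> (\<forall>\<theta>\<in>F. \<theta> \<in> \<Gamma> \<longleftrightarrow> \<theta> \<in> \<Delta>)}" for P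
  have ex: "\<exists>\<theta>. basic \<theta> \<and> (\<forall>\<Gamma>\<in>worlds. \<theta> \<in> \<Gamma> \<longleftrightarrow> \<Gamma> \<in> A' P)" for P
    by (rule insert.IH) (use insert.prems in \<open>auto simp: A'_def\<close>)
  obtain \<theta>1 where \<theta>1: "basic \<theta>1" "\<And>\<Gamma>. \<Gamma> \<in> worlds \<Longrightarrow> \<theta>1 \<in> \<Gamma> \<longleftrightarrow> \<Gamma> \<in> A' (\<lambda>b. b)"
    using ex[of "\<lambda>b. b"] by blast
  obtain \<theta>2 where \<theta>2: "basic \<theta>2" "\<And>\<Gamma>. \<Gamma> \<in> worlds \<Longrightarrow> \<theta>2 \<in> \<Gamma> \<longleftrightarrow> \<Gamma> \<in> A' Not"
    using ex[of Not] by blast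
  note \<theta> = \<theta>1(1) \<theta>2(1) \<theta>1(2) \<theta>2(2)
  have "Or (And f \<theta>1) (And (neg f) \<theta>2) \<in> \<Gamma> \<longleftrightarrow> \<Gamma> \<in> A" if \<Gamma>: "\<Gamma> \<in> worlds" for \<Gamma>
  proof -
    have "Or (And f \<theta>1) (And (neg f) \<theta>2) \<in> \<Gamma> \<longleftrightarrow> (if f \<in> \<Gamma> then \<theta>1 \<in> \<Gamma> else \<theta>2 \<in> \<Gamma>)"
      using worlds_mcs[OF \<Gamma>] f \<theta>(1,2) by (simp add: mcs_Or mcs_And mcs_neg)
    also have "\<dots> \<longleftrightarrow> \<Gamma> \<in> A"
    proof
      assume "\<Gamma> \<in> A"
      then show "if f \<in> \<Gamma> then \<theta>1 \<in> \<Gamma> else \<theta>2 \<in> \<Gamma>" using \<Gamma> by (auto simp: \<theta>(3,4) A'_def)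
    next
      assume "if f \<in> \<Gamma> then \<theta>1 \<in> \<Gamma> else \<theta>2 \<in> \<Gamma>"
      then obtain \<Delta> where \<Delta>: "\<Delta> \<in> worlds" "\<Delta> \<in> A" "\<forall>\<theta>\<in>insert f F. \<theta> \<in> \<Delta> \<longleftrightarrow> \<theta> \<in> \<Gamma>"
        using \<theta>(3,4)[OF \<Gamma>] by (cases "f \<in> \<Gamma>") (auto simp: A'_def)
      show "\<Gamma> \<in> A" by (rule insert.prems(2)[OF \<Delta>(1) \<Gamma> \<Delta>(3,2)])
    qed
    finally show ?thesis .
  qed
  then show ?case using f \<theta>(1,2) by (intro exI[of _ "Or (And f \<theta>1) (And (neg f) \<theta>2)"]) simp
qed

lemma sem_canonical:
  fixes e :: "form set \<Rightarrow> 's"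
  assumes "inj e" "basic \<theta>" "\<Gamma> \<in> worlds"
  shows "e \<Gamma> \<in> sem (e ` worlds) (map_prod e e ` (acc \<inter> worlds \<times> worlds)) (\<lambda>p. e ` {\<Gamma>. Pos p \<in> \<Gamma>}) \<theta>
    \<longleftrightarrow> \<theta> \<in> \<Gamma>"
proof -
  have R: "(e \<Gamma>, b) \<in> map_prod e e ` (acc \<inter> worlds \<times> worlds) \<longleftrightarrow> (\<exists>\<Delta>. b = e \<Delta> \<and> (\<Gamma>, \<Delta>) \<in> acc)"
    if "\<Gamma> \<in> worlds" for \<Gamma> b
    using injD[OF assms(1)] that acc_worlds by fastforce
  note mcs = mcs_And mcs_Or mcs_Box mcs_Dia
  show ?thesis
    using assms(2,3)
  proof (induction \<theta> arbitrary: \<Gamma>)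
    case (Pos p)
    then show ?case by (simp add: inj_image_mem_iff[OF assms(1)])
  next
    case (Neg p)
    then show ?case using mcs_neg[OF worlds_mcs, of \<Gamma> "Pos p"]
      by (simp add: inj_image_mem_iff[OF assms(1)])
  next
    case (Dia \<theta>)
    then show ?case using acc_worlds by (auto simp: R mcs worlds_mcs)
  next
    case (Box \<theta>)
    then show ?case using acc_worlds by (auto simp: R mcs worlds_mcs)
  qed (simp_all add: mcs worlds_mcs)
qed

text \<open>The canonical frame has states of type \<open>form set\<close>, while filtration and
  validity are assumed over \<open>'s\<close>; the injection \<open>e\<close> carries the worlds
  across.\<close>

lemma completeness:
  fixes e :: "form set \<Rightarrow> 's"
  assumes e: "inj e" and canonical: "canonical L"
    and filtration: "admits_filtration (Fr L :: 's frame set) (Fr L :: 's set frame set)"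
    and \<phi>: "mu_c \<phi>" and valid: "\<forall>F \<in> (Fr L :: 's frame set). valid_in F \<phi>"
  shows "\<phi> \<in> mu_c_logic L"
proof (rule ccontr)
  assume "\<phi> \<notin> mu_c_logic L"
  let ?\<psi> = "fsubst Pos \<phi>"
  have "?\<psi> \<notin> mu_c_logic L"
    using mu_c_logic.mp mu_c_logic_renaming[OF \<phi>] \<open>\<phi> \<notin> _\<close> by blast
  moreover have canon\<psi>: "canon ?\<psi>" using \<phi> by (intro canon_fsubst) auto
  ultimately have "Pos (code ?\<psi>) \<notin> T" by (simp add: T_def enum_code)
  then obtain \<Gamma>0 where \<Gamma>0: "\<Gamma>0 \<in> worlds" "\<not> mem \<Gamma>0 ?\<psi>" using mem_code canon\<psi> by (auto simp: T_iff)

  define S where "S = e ` worlds"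
  define R where "R = map_prod e e ` (acc \<inter> worlds \<times> worlds)"
  define V where "V = (\<lambda>p. e ` {\<Gamma>. Pos p \<in> \<Gamma>})"
  define \<Sigma> where "\<Sigma> = cl \<phi> Pos"
  \<comment> \<open>\<open>cl\<close> records no conjunctions or disjunctions, so the arguments of
    its modal formulas are added explicitly and get names too.\<close>
  define P where "P = code ` (\<Sigma> \<union> Dia -` \<Sigma> \<union> Box -` \<Sigma>)"
  \<comment> \<open>\<open>Box (Pos p)\<close> lets boxes cross the quotient relation,
    \<open>Box (Neg p)\<close> diamonds by contraposition; the literals close the set.\<close>
  define \<Phi> where "\<Phi> = (\<Union>p\<in>P. {Pos p, Neg p, Box (Pos p), Box (Neg p)})"
  have "finite (Dia -` \<Sigma>)" "finite (Box -` \<Sigma>)"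
    unfolding \<Sigma>_def by (auto intro!: finite_vimageI finite_cl injI)
  then have \<Phi>: "finite \<Phi>" "\<forall>\<theta>\<in>\<Phi>. basic \<theta>"
    using finite_cl by (auto simp: \<Phi>_def P_def \<Sigma>_def)
  have "FL_closed \<Phi>" by (auto simp: FL_closed_def \<Phi>_def)
  have Lb: "\<forall>\<phi>\<in>L. basic \<phi>" using L_basic by blast
  have "(S, R) \<in> Fr L"
    unfolding S_def R_def
  proof (rule Fr_image[of "fst (canonical_frame L)" acc L e worlds])
    show "(fst (canonical_frame L), acc) \<in> Fr L" using canonical by (simp add: canonical_def)
    show "worlds \<subseteq> fst (canonical_frame L)" by (auto simp: canonical_frame_def worlds_def)
  qed (use e Lb acc_worlds in \<open>auto intro: inj_on_subset\<close>)
  then obtain S' R' V' where filt: "is_filtration S R V \<Phi> S' R' V'" and F': "(S', R') \<in> Fr L"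
    using filtration \<Phi> \<open>FL_closed \<Phi>\<close> unfolding admits_filtration_def by blast

  define q where "q \<Gamma> = fequiv S R V \<Phi> `` {e \<Gamma>}" for \<Gamma>
  have sem: "e \<Gamma> \<in> sem S R V \<theta> \<longleftrightarrow> \<theta> \<in> \<Gamma>" if "\<Gamma> \<in> worlds" "basic \<theta>" for \<Gamma> \<theta>
    using sem_canonical[OF e that(2,1)] by (simp add: S_def R_def V_def)
  have fequiv: "(e \<Gamma>, b) \<in> fequiv S R V \<Phi> \<longleftrightarrow>
      (\<exists>\<Delta>\<in>worlds. b = e \<Delta> \<and> (\<forall>\<theta>\<in>\<Phi>. \<theta> \<in> \<Gamma> \<longleftrightarrow> \<theta> \<in> \<Delta>))" if "\<Gamma> \<in> worlds" for \<Gamma> b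
    using that \<Phi>(2) sem by (auto simp: fequiv_def S_def)
  have q_eq: "q \<Gamma> = q \<Delta> \<longleftrightarrow> (\<forall>\<theta>\<in>\<Phi>. \<theta> \<in> \<Gamma> \<longleftrightarrow> \<theta> \<in> \<Delta>)" if "\<Gamma> \<in> worlds" "\<Delta> \<in> worlds" for \<Gamma> \<Delta>
  proof
    assume "q \<Gamma> = q \<Delta>"
    moreover have "e \<Delta> \<in> q \<Delta>" using fequiv[OF that(2)] that(2) by (auto simp: q_def)
    ultimately have "e \<Delta> \<in> q \<Gamma>" by simp
    then have "(e \<Gamma>, e \<Delta>) \<in> fequiv S R V \<Phi>" by (simp add: q_def)
    then show "\<forall>\<theta>\<in>\<Phi>. \<theta> \<in> \<Gamma> \<longleftrightarrow> \<theta> \<in> \<Delta>"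
      unfolding fequiv[OF that(1)] using injD[OF e] by blast
  qed (auto simp: q_def fequiv that)
  have S': "S' = q ` worlds"
    using filt by (auto simp: is_filtration_def quotient_def q_def S_def)
  have R'_sub: "R' \<subseteq> S' \<times> S'" using F' by (simp add: Fr_def is_frame_def)
  have R'_min: "(q \<Gamma>, q \<Delta>) \<in> R'" if "\<Gamma> \<in> worlds" "(\<Gamma>, \<Delta>) \<in> acc" for \<Gamma> \<Delta>
  proof -
    have \<Delta>: "\<Delta> \<in> worlds" using acc_worlds that by blast
    have "(e \<Gamma>, e \<Delta>) \<in> R" using that \<Delta> by (force simp: R_def)
    moreover have "(e \<Gamma>, e \<Gamma>) \<in> fequiv S R V \<Phi>" "(e \<Delta>, e \<Delta>) \<in> fequiv S R V \<Phi>" "e \<Gamma> \<in> S" "e \<Delta> \<in> S"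
      using that \<Delta> by (auto simp: fequiv_def S_def)
    ultimately have "(q \<Gamma>, q \<Delta>) \<in> Rmin S R V \<Phi>" unfolding Rmin_def q_def by blast
    then show ?thesis using filt by (auto simp: is_filtration_def)
  qed
  have R'_max: "\<theta> \<in> \<Delta>" if "\<Gamma> \<in> worlds" "\<Delta> \<in> worlds" "(q \<Gamma>, q \<Delta>) \<in> R'" "Box \<theta> \<in> \<Phi>" "Box \<theta> \<in> \<Gamma>" for \<Gamma> \<Delta> \<theta>
  proof -
    have b: "basic \<theta>" and \<theta>: "\<theta> \<in> \<Phi>" using \<open>Box \<theta> \<in> \<Phi>\<close> by (auto simp: \<Phi>_def)
    have "(q \<Gamma>, q \<Delta>) \<in> Rmax S R V \<Phi>" using filt that(3) by (auto simp: is_filtration_def)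
    \<comment> \<open>\<open>Rmax\<close> speaks of some representatives of the two classes. As
      \<open>Box \<theta>\<close> and \<open>\<theta>\<close> both lie in \<open>\<Phi>\<close>, the
      conclusion passes to the given ones.\<close>
    then obtain \<Gamma>' \<Delta>' where *: "\<Gamma>' \<in> worlds" "\<Delta>' \<in> worlds" "q \<Gamma> = q \<Gamma>'" "q \<Delta> = q \<Delta>'"
      and "e \<Gamma>' \<in> sem S R V (Box \<theta>) \<Longrightarrow> e \<Delta>' \<in> sem S R V \<theta>"
      using \<open>Box \<theta> \<in> \<Phi>\<close> unfolding Rmax_def q_def S_def by blast
    then have "Box \<theta> \<in> \<Gamma>' \<Longrightarrow> \<theta> \<in> \<Delta>'" using sem[OF *(1), of "Box \<theta>"] sem[OF *(2), of \<theta>] b by simp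
    then show ?thesis using * q_eq that \<theta> by blast
  qed

  \<comment> \<open>Validity is assumed for states in \<open>'s\<close>, but the quotient has states
    in \<open>'s set\<close>; each class is replaced by a chosen element, injectively since distinct
    classes are disjoint.\<close>
  define rep :: "'s set \<Rightarrow> 's" where "rep A = (SOME x. x \<in> A)" for A
  have rep: "inj_on rep S'"
  proof (rule inj_onI)
    have *: "\<exists>\<Delta>\<in>worlds. rep (q \<Gamma>) = e \<Delta> \<and> q \<Delta> = q \<Gamma>" if \<Gamma>: "\<Gamma> \<in> worlds" for \<Gamma>
    proof -
      have "e \<Gamma> \<in> q \<Gamma>" using that by (auto simp: q_def fequiv)
      then have "rep (q \<Gamma>) \<in> q \<Gamma>" unfolding rep_def by (rule someI)
      then obtain \<Delta> where "\<Delta> \<in> worlds" "rep (q \<Gamma>) = e \<Delta>" "\<forall>\<theta>\<in>\<Phi>. \<theta> \<in> \<Gamma> \<longleftrightarrow> \<theta> \<in> \<Delta>"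
        using \<Gamma> by (auto simp: q_def fequiv)
      then show ?thesis using q_eq[of \<Delta> \<Gamma>] \<Gamma> by (intro bexI[of _ \<Delta>]) auto
    qed
    fix A B assume "A \<in> S'" "B \<in> S'" "rep A = rep B"
    then obtain \<Gamma> \<Delta> where "\<Gamma> \<in> worlds" "A = q \<Gamma>" "\<Delta> \<in> worlds" "B = q \<Delta>" "rep (q \<Gamma>) = rep (q \<Delta>)"
      unfolding S' by blast
    then show "A = B" using *[of \<Gamma>] *[of \<Delta>] injD[OF e] by metis
  qed
  define R'' where "R'' = map_prod rep rep ` (R' \<inter> S' \<times> S')"
  define c where "c \<Gamma> = rep (q \<Gamma>)" for \<Gamma>
  have c_eq: "c \<Gamma> = c \<Delta> \<longleftrightarrow> q \<Gamma> = q \<Delta>" if "\<Gamma> \<in> worlds" "\<Delta> \<in> worlds" for \<Gamma> \<Delta>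
    using rep that by (auto simp: c_def S' inj_on_eq_iff)
  have c_image: "c ` worlds = rep ` S'" by (auto simp: c_def S')
  have F'': "(c ` worlds, R'') \<in> Fr L"
    unfolding c_image R''_def using F' Lb rep R'_sub by (intro Fr_image) auto
  have R'': "(c \<Gamma>, c \<Delta>) \<in> R'' \<longleftrightarrow> (q \<Gamma>, q \<Delta>) \<in> R'" if "\<Gamma> \<in> worlds" "\<Delta> \<in> worlds" for \<Gamma> \<Delta>
  proof
    assume "(c \<Gamma>, c \<Delta>) \<in> R''"
    then obtain A B where "(A, B) \<in> R'" "A \<in> S'" "B \<in> S'" "rep (q \<Gamma>) = rep A" "rep (q \<Delta>) = rep B"
      by (auto simp: R''_def c_def)
    then show "(q \<Gamma>, q \<Delta>) \<in> R'" using rep that by (auto simp: S' inj_on_eq_iff)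
  qed (use that in \<open>force simp: R''_def c_def S'\<close>)

  have code_\<Phi>: "{Pos (code a), Neg (code a), Box (Pos (code a)), Box (Neg (code a))} \<subseteq> \<Phi>"
    if "a \<in> \<Sigma> \<or> Dia a \<in> \<Sigma> \<or> Box a \<in> \<Sigma>" for a
    using that by (auto simp: \<Phi>_def P_def)
  interpret canonical_quotient L worlds acc mem c R'' \<Sigma>
  proof
    fix \<Gamma> \<Delta> a
    assume \<Gamma>: "\<Gamma> \<in> worlds" and \<Delta>: "\<Delta> \<in> worlds" and R: "(c \<Gamma>, c \<Delta>) \<in> R''" and a: "canon a"
    have R': "(q \<Gamma>, q \<Delta>) \<in> R'" using R R'' \<Gamma> \<Delta> by blast
    show "mem \<Delta> a" if "Box a \<in> \<Sigma>" "mem \<Gamma> (Box a)"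
      using R'_max[OF \<Gamma> \<Delta> R', of "Pos (code a)"] code_\<Phi>[of a] that mem_code[OF \<Delta> a]
        mem_code_simps(5)[OF \<Gamma> a a] by auto
    \<comment> \<open>If the diamond failed, \<open>Box (Neg (code a))\<close> would be in \<Gamma>,
      and the quotient edge would put \<open>Neg (code a)\<close> into \<Delta>.\<close>
    show "mem \<Gamma> (Dia a)" if "Dia a \<in> \<Sigma>" "mem \<Delta> a"
      using R'_max[OF \<Gamma> \<Delta> R', of "Neg (code a)"] code_\<Phi>[of a] that mem_code[OF \<Delta> a]
        mem_code_simps(4)[OF \<Gamma> a a] mcs_neg[OF worlds_mcs[OF \<Gamma>], of "Dia (Pos (code a))"]
        mcs_neg[OF worlds_mcs[OF \<Delta>], of "Pos (code a)"] by auto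
  next
    fix \<Gamma> \<Delta> a
    assume "a \<in> \<Sigma>" "canon a" "\<Gamma> \<in> worlds" "\<Delta> \<in> worlds" "c \<Gamma> = c \<Delta>" "mem \<Gamma> a"
    then show "mem \<Delta> a" using c_eq q_eq code_\<Phi>[of a] by (auto simp: mem_code)
  next
    fix U assume U: "U \<subseteq> c ` worlds"
    have "\<exists>\<theta>. basic \<theta> \<and> (\<forall>\<Gamma>\<in>worlds. \<theta> \<in> \<Gamma> \<longleftrightarrow> \<Gamma> \<in> {\<Gamma>. c \<Gamma> \<in> U})"
      by (rule worlds_definable[OF \<Phi>]) (use c_eq q_eq in force)
    then obtain \<theta> where \<theta>: "basic \<theta>" "\<forall>\<Gamma>\<in>worlds. \<theta> \<in> \<Gamma> \<longleftrightarrow> c \<Gamma> \<in> U" by auto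
    then show "\<exists>\<gamma>. canon \<gamma> \<and> (\<forall>\<Gamma>\<in>worlds. mem \<Gamma> \<gamma> \<longleftrightarrow> c \<Gamma> \<in> U)"
      by (intro exI[of _ "fsubst enum \<theta>"]) (simp add: mem_fsubst canon_fsubst basic_mu_c)
  next
    show "R'' \<subseteq> c ` worlds \<times> c ` worlds" by (auto simp: R''_def c_image)
  next
    show "imp a b \<in> mu_c_logic L \<longleftrightarrow> (\<forall>\<Gamma>\<in>worlds. mem \<Gamma> a \<longrightarrow> mem \<Gamma> b)" if "canon a" "canon b" for a b
      using that by (rule imp_provable_iff)
  next
    show "(c \<Gamma>, c \<Delta>) \<in> R''" if "\<Gamma> \<in> worlds" "\<Delta> \<in> worlds" "(\<Gamma>, \<Delta>) \<in> acc" for \<Gamma> \<Delta>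
      using R'' R'_min that by blast
  next
    fix \<Gamma> a assume *: "\<Gamma> \<in> worlds" "canon a"
    note mcs = worlds_mcs[OF *(1)]
    show "mem \<Gamma> (neg a) \<longleftrightarrow> \<not> mem \<Gamma> a"
      using mem_code_simps(1)[OF *(1,2,2)] mcs_neg[OF mcs, of "Pos (code a)"] mem_code[OF *] by simp
    show "mem \<Gamma> (Dia a) \<longleftrightarrow> (\<exists>\<Delta>\<in>worlds. (\<Gamma>, \<Delta>) \<in> acc \<and> mem \<Delta> a)"
      using mem_code_simps(4)[OF *(1,2,2)] mcs_Dia[OF mcs, of "Pos (code a)"]
        acc_worlds[OF *(1)] mem_code[OF _ *(2)] by auto
    show "mem \<Gamma> (Box a) \<longleftrightarrow> (\<forall>\<Delta>\<in>worlds. (\<Gamma>, \<Delta>) \<in> acc \<longrightarrow> mem \<Delta> a)"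
      using mem_code_simps(5)[OF *(1,2,2)] mcs_Box[OF mcs, of "Pos (code a)"]
        acc_worlds[OF *(1)] mem_code[OF _ *(2)] by auto
    fix b assume b: "canon b"
    show "mem \<Gamma> (Or a b) \<longleftrightarrow> mem \<Gamma> a \<or> mem \<Gamma> b"
      using mem_code_simps(2)[OF * b] mcs_Or[OF mcs, of "Pos (code a)" "Pos (code b)"]
        mem_code[OF *] mem_code[OF *(1) b] by simp
    show "mem \<Gamma> (And a b) \<longleftrightarrow> mem \<Gamma> a \<and> mem \<Gamma> b"
      using mem_code_simps(3)[OF * b] mcs_And[OF mcs, of "Pos (code a)" "Pos (code b)"]
        mem_code[OF *] mem_code[OF *(1) b] by simp
  qed
  have "mem \<Gamma>0 ?\<psi> \<longleftrightarrow> c \<Gamma>0 \<in> Sem Pos \<phi>"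
    using \<phi> \<Gamma>0(1) by (intro truth_lemma) (simp_all add: \<Sigma>_def)
  \<comment> \<open>Validity in the copied quotient is applied to the valuation read off from
    membership, \<open>ext \<circ> Pos\<close>.\<close>
  moreover have "c \<Gamma>0 \<in> Sem Pos \<phi>"
    using bspec[OF valid F''] \<Gamma>0(1) by (simp add: valid_in_def)
  ultimately show False using \<Gamma>0(2) by simp
qed

end

theorem theorem4p14:
  fixes L :: "form set" and e :: "form set \<Rightarrow> 's"
  assumes large_universe: "inj e"
    and normal: "normal_modal_logic L"
    and canonical: "canonical L"
    and filtration: "admits_filtration (Fr L :: 's frame set) (Fr L :: 's set frame set)"
  shows "\<forall>\<phi>. mu_c \<phi> \<longrightarrow>
           (\<phi> \<in> mu_c_logic L \<longleftrightarrow> (\<forall>F \<in> (Fr L :: 's frame set). valid_in F \<phi>))"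
proof -
  interpret normal_logic L by unfold_locales (rule normal)
  show ?thesis using soundness completeness[OF large_universe canonical filtration] by blast
qed

end
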